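(* Let $V$ be the ground model, let $\mathcal{A}\in V$ be an infinite Boolean algebra, and let $\mathbb{P}\in V$ be a notion of forcing adding a dominating real over $V$. Let $G$ be a $\mathbb{P}$-generic filter over $V$. Then, in $V[G]$, $\mathcal{A}$ does not have the Nikodym property.
   Context: A measure on a Boolean algebra $\mathcal{A}$ is a finitely additive function $\mu\colon\mathcal{A}\to\mathbb{R}$ of bounded total variation; it extends uniquely to a signed Radon measure on the Stone space $St(\mathcal{A})$. A sequence $(\mu_n)$ of measures is pointwise null if $\mu_n(A)\to0$ for all $A\in\mathcal{A}$, and weak* null if $\int f\,d\mu_n\to0$ for all continuous $f\colon St(\mathcal{A})\to\mathbb{R}$. $\mathcal{A}$ has the Nikodym property if every pointwise null sequence of measures on $\mathcal{A}$ is weak* null. A real $f\in\omega^\omega\cap V[G]$ is dominating over $V$ if for every $g\in\omega^\omega\cap V$ we have $g(n)\le f(n)$ for all but finitely many $n$. *)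

theory Defs
  imports Complex_Main
begin

text \<open>
  Forcing over the universe. The ground model \<open>V\<close> is the universe of HOL: a notion of forcing
  in \<open>V\<close> is an arbitrary preordered type \<open>'p\<close> (smaller conditions are stronger), a Boolean
  algebra in \<open>V\<close> is an arbitrary type of class \<^class>\<open>boolean_algebra\<close>. There is no
  \<open>V\<close>-generic filter inside \<open>V\<close>, so, as usual when forcing over the universe, truth in \<open>V[G]\<close>
  is expressed through \<open>P\<close>-names and the forcing relation: a sentence holds in
  \<open>V[G]\<close> for every \<open>V\<close>-generic filter \<open>G\<close> iff every condition forces it.

  A sentence of the forcing language is identified with the set of conditions forcing it, so
  \<open>\<phi> p\<close> reads ``\<open>p\<close> forces \<open>\<phi>\<close>''. Negation, conjunction and the universal quantifier have the
  standard forcing clauses; the other connectives are their classical abbreviations.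
\<close>

type_synonym 'p sentence = "'p \<Rightarrow> bool"

definition fNot :: "'p::preorder sentence \<Rightarrow> 'p sentence"  (\<open>\<^bold>\<not> _\<close> [40] 40)
  where "(\<^bold>\<not> \<phi>) = (\<lambda>p. \<forall>q\<le>p. \<not> \<phi> q)"

definition fAnd :: "'p::preorder sentence \<Rightarrow> 'p sentence \<Rightarrow> 'p sentence"  (infixr \<open>\<^bold>\<and>\<close> 35)
  where "(\<phi> \<^bold>\<and> \<psi>) = (\<lambda>p. \<phi> p \<and> \<psi> p)"

definition fAll :: "('x \<Rightarrow> 'p::preorder sentence) \<Rightarrow> 'p sentence"  (binder \<open>\<^bold>\<forall>\<close> 10)
  where "(\<^bold>\<forall>x. \<Phi> x) = (\<lambda>p. \<forall>x. \<Phi> x p)"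

definition fOr :: "'p::preorder sentence \<Rightarrow> 'p sentence \<Rightarrow> 'p sentence"  (infixr \<open>\<^bold>\<or>\<close> 30)
  where "(\<phi> \<^bold>\<or> \<psi>) = (\<^bold>\<not> (\<^bold>\<not> \<phi> \<^bold>\<and> \<^bold>\<not> \<psi>))"

definition fImp :: "'p::preorder sentence \<Rightarrow> 'p sentence \<Rightarrow> 'p sentence"  (infixr \<open>\<^bold>\<longrightarrow>\<close> 25)
  where "(\<phi> \<^bold>\<longrightarrow> \<psi>) = (\<^bold>\<not> (\<phi> \<^bold>\<and> \<^bold>\<not> \<psi>))"

definition fIff :: "'p::preorder sentence \<Rightarrow> 'p sentence \<Rightarrow> 'p sentence"  (infixr \<open>\<^bold>\<longleftrightarrow>\<close> 25)
  where "(\<phi> \<^bold>\<longleftrightarrow> \<psi>) = ((\<phi> \<^bold>\<longrightarrow> \<psi>) \<^bold>\<and> (\<psi> \<^bold>\<longrightarrow> \<phi>))"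

definition fEx :: "('x \<Rightarrow> 'p::preorder sentence) \<Rightarrow> 'p sentence"  (binder \<open>\<^bold>\<exists>\<close> 10)
  where "(\<^bold>\<exists>x. \<Phi> x) = (\<^bold>\<not> (\<^bold>\<forall>x. \<^bold>\<not> \<Phi> x))"

text \<open>An absolute statement about elements of \<open>V\<close>.\<close>

definition ground :: "bool \<Rightarrow> 'p::preorder sentence"
  where "ground b = (\<lambda>p. b)"

definition forced :: "'p::preorder sentence \<Rightarrow> bool"
  where "forced \<phi> \<longleftrightarrow> (\<forall>p. \<phi> p)"

text \<open>
  Names. The elements of (the check name of) a ground set are denoted by the elements of the
  corresponding HOL type, with forced equality \<open>geq\<close>. If the elements of a set \<open>X\<close> of \<open>V[G]\<close> are
  denoted by the elements of a type \<open>'x\<close>, with forced equality \<open>E\<close>, then every subset of \<open>X\<close>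
  in \<open>V[G]\<close> has a name consisting of pairs (element of \<open>'x\<close>, condition); \<open>mem\<close> is the usual
  definition of forcing for membership, and \<open>seteq\<close> is extensionality. By fullness, a finite
  or infinite sequence of elements of \<open>X\<close> in \<open>V[G]\<close> is given by a sequence in \<open>V\<close> of names, and
  finite sequences of elements of a ground set are themselves in \<open>V\<close>.
\<close>

type_synonym ('x, 'p) name = "('x \<times> 'p) set"

definition geq :: "'x \<Rightarrow> 'x \<Rightarrow> 'p::preorder sentence"
  where "geq x y = ground (x = y)"

definition mem :: "('x \<Rightarrow> 'x \<Rightarrow> 'p sentence) \<Rightarrow> 'x \<Rightarrow> ('x, 'p::preorder) name \<Rightarrow> 'p sentence"
  where "mem E x \<tau> = (\<lambda>p. \<forall>q\<le>p. \<exists>r\<le>q. \<exists>(y, s)\<in>\<tau>. r \<le> s \<and> E x y r)"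

definition seteq ::
    "('x \<Rightarrow> 'x \<Rightarrow> 'p sentence) \<Rightarrow> ('x, 'p::preorder) name \<Rightarrow> ('x, 'p) name \<Rightarrow> 'p sentence"
  where "seteq E \<sigma> \<tau> = (\<^bold>\<forall>x. mem E x \<sigma> \<^bold>\<longleftrightarrow> mem E x \<tau>)"

definition paireq ::
    "('x \<Rightarrow> 'x \<Rightarrow> 'p sentence) \<Rightarrow> ('y \<Rightarrow> 'y \<Rightarrow> 'p sentence) \<Rightarrow> 'x \<times> 'y \<Rightarrow> 'x \<times> 'y \<Rightarrow> 'p::preorder sentence"
  where "paireq E F u v = (E (fst u) (fst v) \<^bold>\<and> F (snd u) (snd v))"

definition baire_real :: "(nat \<times> nat, 'p::preorder) name \<Rightarrow> 'p sentence"
  where "baire_real f =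
    ((\<^bold>\<forall>n. \<^bold>\<exists>k. mem geq (n, k) f) \<^bold>\<and>
     (\<^bold>\<forall>n k l. mem geq (n, k) f \<^bold>\<and> mem geq (n, l) f \<^bold>\<longrightarrow> ground (k = l)))"

definition dominating_over_V :: "(nat \<times> nat, 'p::preorder) name \<Rightarrow> 'p sentence"
  where "dominating_over_V f =
    (\<^bold>\<forall>g::nat \<Rightarrow> nat. \<^bold>\<exists>N. \<^bold>\<forall>n k. ground (N \<le> n) \<^bold>\<and> mem geq (n, k) f \<^bold>\<longrightarrow> ground (g n \<le> k))"

definition adds_dominating_real :: "'p::preorder itself \<Rightarrow> bool"
  where "adds_dominating_real _ \<longleftrightarrow>
    forced ((\<^bold>\<exists>f. baire_real f \<^bold>\<and> dominating_over_V f) :: 'p sentence)"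

text \<open>
  Real numbers of \<open>V[G]\<close> are Dedekind cuts in \<open>V[G]\<close>: \<open>x q\<close> is the sentence
  ``the rational \<open>q\<close> is smaller than \<open>x\<close>''.
\<close>

type_synonym 'p cut = "rat \<Rightarrow> 'p sentence"

definition is_real :: "'p::preorder cut \<Rightarrow> 'p sentence"
  where "is_real x =
    ((\<^bold>\<exists>q. x q) \<^bold>\<and> (\<^bold>\<exists>q. \<^bold>\<not> x q) \<^bold>\<and>
     (\<^bold>\<forall>q r. ground (r < q) \<^bold>\<and> x q \<^bold>\<longrightarrow> x r) \<^bold>\<and>
     (\<^bold>\<forall>q. x q \<^bold>\<longrightarrow> (\<^bold>\<exists>r. ground (q < r) \<^bold>\<and> x r)))"

definition req :: "'p::preorder cut \<Rightarrow> 'p cut \<Rightarrow> 'p sentence"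
  where "req x y = (\<^bold>\<forall>q. x q \<^bold>\<longleftrightarrow> y q)"

definition rle :: "'p::preorder cut \<Rightarrow> 'p cut \<Rightarrow> 'p sentence"
  where "rle x y = (\<^bold>\<forall>q. x q \<^bold>\<longrightarrow> y q)"

definition rless :: "'p::preorder cut \<Rightarrow> 'p cut \<Rightarrow> 'p sentence"
  where "rless x y = (\<^bold>\<exists>q. \<^bold>\<not> x q \<^bold>\<and> y q)"

definition rconst :: "rat \<Rightarrow> 'p::preorder cut"
  where "rconst c = (\<lambda>q. ground (q < c))"

definition radd :: "'p::preorder cut \<Rightarrow> 'p cut \<Rightarrow> 'p cut"
  where "radd x y = (\<lambda>q. \<^bold>\<exists>a b. x a \<^bold>\<and> y b \<^bold>\<and> ground (q = a + b))"

definition rminus :: "'p::preorder cut \<Rightarrow> 'p cut"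
  where "rminus x = (\<lambda>q. \<^bold>\<exists>a. \<^bold>\<not> x a \<^bold>\<and> ground (q < - a))"

definition rdiff :: "'p::preorder cut \<Rightarrow> 'p cut \<Rightarrow> 'p cut"
  where "rdiff x y = radd x (rminus y)"

definition rabs :: "'p::preorder cut \<Rightarrow> 'p cut"
  where "rabs x = (\<lambda>q. x q \<^bold>\<or> rminus x q)"

text \<open>The product, by interval arithmetic with \<open>a < x \<le> b\<close> and \<open>c < y \<le> d\<close>.\<close>

definition rmult :: "'p::preorder cut \<Rightarrow> 'p cut \<Rightarrow> 'p cut"
  where "rmult x y = (\<lambda>q. \<^bold>\<exists>a b c d. x a \<^bold>\<and> \<^bold>\<not> x b \<^bold>\<and> y c \<^bold>\<and> \<^bold>\<not> y d \<^bold>\<and>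
    ground (q < a * c \<and> q < a * d \<and> q < b * c \<and> q < b * d))"

definition rsum :: "'p::preorder cut list \<Rightarrow> 'p cut"
  where "rsum xs = foldr radd xs (rconst 0)"

text \<open>
  A real-valued function \<open>F\<close> on a set \<open>D\<close> of \<open>V[G]\<close> is coded by \<open>{(s, q). s \<in> D \<and> q < F s}\<close>.
\<close>

definition app ::
    "('s \<Rightarrow> 's \<Rightarrow> 'p sentence) \<Rightarrow> ('s \<times> rat, 'p::preorder) name \<Rightarrow> 's \<Rightarrow> 'p cut"
  where "app E F s = (\<lambda>q. mem (paireq E geq) (s, q) F)"

definition real_fun_on ::
    "('s \<Rightarrow> 's \<Rightarrow> 'p sentence) \<Rightarrow> ('s \<Rightarrow> 'p sentence) \<Rightarrow> ('s \<times> rat, 'p::preorder) name \<Rightarrow> 'p sentence"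
  where "real_fun_on E D F =
    ((\<^bold>\<forall>s q. app E F s q \<^bold>\<longrightarrow> D s) \<^bold>\<and> (\<^bold>\<forall>s. D s \<^bold>\<longrightarrow> is_real (app E F s)))"

text \<open>
  Finite families of elements of \<open>'a\<close> in \<open>V[G]\<close> belong to \<open>V\<close>, so the total variation is a
  supremum over lists from \<open>V\<close>.
\<close>

definition ba_measure :: "('a::boolean_algebra \<times> rat, 'p::preorder) name \<Rightarrow> 'p sentence"
  where "ba_measure \<mu> =
    (real_fun_on geq (\<lambda>_. ground True) \<mu> \<^bold>\<and>
     (\<^bold>\<forall>a b. ground (inf a b = bot) \<^bold>\<longrightarrow>
        req (app geq \<mu> (sup a b)) (radd (app geq \<mu> a) (app geq \<mu> b))) \<^bold>\<and>
     (\<^bold>\<exists>K. \<^bold>\<forall>as. ground (sorted_wrt (\<lambda>a b. inf a b = bot) as) \<^bold>\<longrightarrow>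
        rle (rsum (map (\<lambda>a. rabs (app geq \<mu> a)) as)) (rconst K)))"

definition pointwise_null ::
    "(nat \<Rightarrow> ('a::boolean_algebra \<times> rat, 'p::preorder) name) \<Rightarrow> 'p sentence"
  where "pointwise_null \<mu> =
    (\<^bold>\<forall>a \<epsilon>. ground (0 < \<epsilon>) \<^bold>\<longrightarrow>
      (\<^bold>\<exists>N. \<^bold>\<forall>n. ground (N \<le> n) \<^bold>\<longrightarrow> rless (rabs (app geq (\<mu> n) a)) (rconst \<epsilon>)))"

text \<open>
  The Stone space of \<open>'a\<close> as computed in \<open>V[G]\<close>: its points are all ultrafilters in \<open>V[G]\<close>,
  its topology is generated by the clopen sets \<open>{U. a \<in> U}\<close>.
\<close>

type_synonym ('a, 'p) point = "('a, 'p) name"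
type_synonym ('a, 'p) pointset = "(('a, 'p) point, 'p) name"

definition ultrafilter :: "('a::boolean_algebra, 'p::preorder) point \<Rightarrow> 'p sentence"
  where "ultrafilter U =
    (mem geq top U \<^bold>\<and> \<^bold>\<not> mem geq bot U \<^bold>\<and>
     (\<^bold>\<forall>a b. mem geq a U \<^bold>\<and> mem geq b U \<^bold>\<longrightarrow> mem geq (inf a b) U) \<^bold>\<and>
     (\<^bold>\<forall>a b. mem geq a U \<^bold>\<and> ground (a \<le> b) \<^bold>\<longrightarrow> mem geq b U) \<^bold>\<and>
     (\<^bold>\<forall>a. mem geq a U \<^bold>\<or> mem geq (- a) U))"

definition pmem :: "('a, 'p) point \<Rightarrow> ('a, 'p::preorder) pointset \<Rightarrow> 'p sentence"
  where "pmem U B = mem (seteq geq) U B"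

definition smem :: "('a, 'p) pointset \<Rightarrow> (('a, 'p::preorder) pointset, 'p) name \<Rightarrow> 'p sentence"
  where "smem B \<S> = mem (seteq (seteq geq)) B \<S>"

definition psubset_eq :: "('a, 'p::preorder) pointset \<Rightarrow> ('a, 'p) pointset \<Rightarrow> 'p sentence"
  where "psubset_eq B C = (\<^bold>\<forall>U. pmem U B \<^bold>\<longrightarrow> pmem U C)"

definition pdisjoint :: "('a, 'p::preorder) pointset \<Rightarrow> ('a, 'p) pointset \<Rightarrow> 'p sentence"
  where "pdisjoint B C = (\<^bold>\<forall>U. \<^bold>\<not> (pmem U B \<^bold>\<and> pmem U C))"

definition in_stone :: "('a::boolean_algebra, 'p::preorder) pointset \<Rightarrow> 'p sentence"
  where "in_stone B = (\<^bold>\<forall>U. pmem U B \<^bold>\<longrightarrow> ultrafilter U)"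

definition stone_open :: "('a::boolean_algebra, 'p::preorder) pointset \<Rightarrow> 'p sentence"
  where "stone_open B =
    (in_stone B \<^bold>\<and>
     (\<^bold>\<forall>U. pmem U B \<^bold>\<longrightarrow>
        (\<^bold>\<exists>a. mem geq a U \<^bold>\<and> (\<^bold>\<forall>W. ultrafilter W \<^bold>\<and> mem geq a W \<^bold>\<longrightarrow> pmem W B))))"

definition stone_compl ::
    "('a::boolean_algebra, 'p::preorder) pointset \<Rightarrow> ('a, 'p) pointset \<Rightarrow> 'p sentence"
  where "stone_compl B C = (\<^bold>\<forall>U. pmem U C \<^bold>\<longleftrightarrow> ultrafilter U \<^bold>\<and> \<^bold>\<not> pmem U B)"

definition stone_closed :: "('a::boolean_algebra, 'p::preorder) pointset \<Rightarrow> 'p sentence"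
  where "stone_closed B = (in_stone B \<^bold>\<and> (\<^bold>\<exists>C. stone_compl B C \<^bold>\<and> stone_open C))"

definition stone_sigma_algebra ::
    "(('a::boolean_algebra, 'p::preorder) pointset, 'p) name \<Rightarrow> 'p sentence"
  where "stone_sigma_algebra \<S> =
    ((\<^bold>\<forall>B. smem B \<S> \<^bold>\<longrightarrow> in_stone B) \<^bold>\<and>
     smem {} \<S> \<^bold>\<and>
     (\<^bold>\<forall>B C. smem B \<S> \<^bold>\<and> stone_compl B C \<^bold>\<longrightarrow> smem C \<S>) \<^bold>\<and>
     (\<^bold>\<forall>(X :: nat \<Rightarrow> ('a, 'p) pointset) B.
        (\<^bold>\<forall>n. smem (X n) \<S>) \<^bold>\<and> (\<^bold>\<forall>U. pmem U B \<^bold>\<longleftrightarrow> (\<^bold>\<exists>n. pmem U (X n))) \<^bold>\<longrightarrow> smem B \<S>))"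

definition stone_borel :: "('a::boolean_algebra, 'p::preorder) pointset \<Rightarrow> 'p sentence"
  where "stone_borel B =
    (\<^bold>\<forall>\<S>. stone_sigma_algebra \<S> \<^bold>\<and> (\<^bold>\<forall>C. stone_open C \<^bold>\<longrightarrow> smem C \<S>) \<^bold>\<longrightarrow> smem B \<S>)"

definition stone_continuous ::
    "(('a::boolean_algebra, 'p::preorder) point \<times> rat, 'p) name \<Rightarrow> 'p sentence"
  where "stone_continuous f =
    (real_fun_on (seteq geq) ultrafilter f \<^bold>\<and>
     (\<^bold>\<forall>U \<epsilon>. ultrafilter U \<^bold>\<and> ground (0 < \<epsilon>) \<^bold>\<longrightarrow>
        (\<^bold>\<exists>a. mem geq a U \<^bold>\<and>
          (\<^bold>\<forall>W. ultrafilter W \<^bold>\<and> mem geq a W \<^bold>\<longrightarrow>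
             rless (rabs (rdiff (app (seteq geq) f W) (app (seteq geq) f U))) (rconst \<epsilon>)))))"

type_synonym ('a, 'p) setfun = "(('a, 'p) pointset \<times> rat, 'p) name"

definition sval :: "('a, 'p::preorder) setfun \<Rightarrow> ('a, 'p) pointset \<Rightarrow> 'p cut"
  where "sval m B = app (seteq (seteq geq)) m B"

definition disjoint_borel_list ::
    "('a::boolean_algebra, 'p::preorder) pointset list \<Rightarrow> 'p sentence"
  where "disjoint_borel_list Bs =
    ((\<^bold>\<forall>i. ground (i < length Bs) \<^bold>\<longrightarrow> stone_borel (Bs ! i)) \<^bold>\<and>
     (\<^bold>\<forall>i j. ground (i < j \<and> j < length Bs) \<^bold>\<longrightarrow> pdisjoint (Bs ! i) (Bs ! j)))"

definition signed_borel_measure :: "('a::boolean_algebra, 'p::preorder) setfun \<Rightarrow> 'p sentence"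
  where "signed_borel_measure m =
    (real_fun_on (seteq (seteq geq)) stone_borel m \<^bold>\<and>
     (\<^bold>\<forall>(X :: nat \<Rightarrow> ('a, 'p) pointset) B.
        (\<^bold>\<forall>n. stone_borel (X n)) \<^bold>\<and>
        (\<^bold>\<forall>i j. ground (i \<noteq> j) \<^bold>\<longrightarrow> pdisjoint (X i) (X j)) \<^bold>\<and>
        (\<^bold>\<forall>U. pmem U B \<^bold>\<longleftrightarrow> (\<^bold>\<exists>n. pmem U (X n))) \<^bold>\<longrightarrow>
        (\<^bold>\<forall>\<epsilon>. ground (0 < \<epsilon>) \<^bold>\<longrightarrow>
          (\<^bold>\<exists>N. \<^bold>\<forall>n. ground (N \<le> n) \<^bold>\<longrightarrow>
             rless (rabs (rdiff (rsum (map (\<lambda>i. sval m (X i)) [0..<n])) (sval m B))) (rconst \<epsilon>)))))"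

text \<open>
  Inner regularity of the total variation of \<open>m\<close>: the variation of \<open>B - K\<close> is at most \<open>\<epsilon>\<close>.
  The Stone space is compact, so its compact subsets are the closed ones.
\<close>

definition radon_measure :: "('a::boolean_algebra, 'p::preorder) setfun \<Rightarrow> 'p sentence"
  where "radon_measure m =
    (signed_borel_measure m \<^bold>\<and>
     (\<^bold>\<forall>B \<epsilon>. stone_borel B \<^bold>\<and> ground (0 < \<epsilon>) \<^bold>\<longrightarrow>
        (\<^bold>\<exists>K. stone_closed K \<^bold>\<and> psubset_eq K B \<^bold>\<and>
          (\<^bold>\<forall>Cs. disjoint_borel_list Cs \<^bold>\<and>
             (\<^bold>\<forall>i. ground (i < length Cs) \<^bold>\<longrightarrow> psubset_eq (Cs ! i) B \<^bold>\<and> pdisjoint (Cs ! i) K) \<^bold>\<longrightarrow>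
             rle (rsum (map (\<lambda>C. rabs (sval m C)) Cs)) (rconst \<epsilon>)))))"

definition extends_measure ::
    "('a::boolean_algebra, 'p::preorder) setfun \<Rightarrow> ('a \<times> rat, 'p) name \<Rightarrow> 'p sentence"
  where "extends_measure m \<mu> =
    (\<^bold>\<forall>a B. (\<^bold>\<forall>U. pmem U B \<^bold>\<longleftrightarrow> ultrafilter U \<^bold>\<and> mem geq a U) \<^bold>\<longrightarrow>
       req (sval m B) (app geq \<mu> a))"

text \<open>
  The integral of a (bounded, Borel) function \<open>f\<close> is the limit of the integrals of simple
  functions converging uniformly to \<open>f\<close>; \<open>bs\<close> lists the pieces of a finite Borel partition
  with the (rational) values of the simple function on them.
\<close>

definition has_stone_integral ::
    "(('a::boolean_algebra, 'p::preorder) point \<times> rat, 'p) name \<Rightarrow> ('a, 'p) setfun \<Rightarrow> 'p cut \<Rightarrow> 'p sentence"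
  where "has_stone_integral f m I =
    (\<^bold>\<forall>\<epsilon>. ground (0 < \<epsilon>) \<^bold>\<longrightarrow>
      (\<^bold>\<exists>\<delta>. ground (0 < \<delta>) \<^bold>\<and>
        (\<^bold>\<forall>bs :: (('a, 'p) pointset \<times> rat) list.
           disjoint_borel_list (map fst bs) \<^bold>\<and>
           (\<^bold>\<forall>U. ultrafilter U \<^bold>\<longrightarrow> (\<^bold>\<exists>i. ground (i < length bs) \<^bold>\<and> pmem U (fst (bs ! i)))) \<^bold>\<and>
           (\<^bold>\<forall>i U. ground (i < length bs) \<^bold>\<and> pmem U (fst (bs ! i)) \<^bold>\<longrightarrow>
              rle (rabs (rdiff (app (seteq geq) f U) (rconst (snd (bs ! i))))) (rconst \<delta>)) \<^bold>\<longrightarrow>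
           rless (rabs (rdiff (rsum (map (\<lambda>(B, c). rmult (rconst c) (sval m B)) bs)) I)) (rconst \<epsilon>))))"

text \<open>
  The integral of \<open>f\<close> against \<open>\<mu> n\<close> is the integral against the Radon measure on the Stone space
  extending \<open>\<mu> n\<close>, which exists and is unique.
\<close>

definition weak_star_null ::
    "(nat \<Rightarrow> ('a::boolean_algebra \<times> rat, 'p::preorder) name) \<Rightarrow> 'p sentence"
  where "weak_star_null \<mu> =
    (\<^bold>\<forall>f \<epsilon>. stone_continuous f \<^bold>\<and> ground (0 < \<epsilon>) \<^bold>\<longrightarrow>
      (\<^bold>\<exists>N. \<^bold>\<forall>n. ground (N \<le> n) \<^bold>\<longrightarrow>
        (\<^bold>\<exists>m (I :: (rat, 'p) name).
           radon_measure m \<^bold>\<and> extends_measure m (\<mu> n) \<^bold>\<and>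
           is_real (\<lambda>q. mem geq q I) \<^bold>\<and> has_stone_integral f m (\<lambda>q. mem geq q I) \<^bold>\<and>
           rless (rabs (\<lambda>q. mem geq q I)) (rconst \<epsilon>))))"

definition nikodym_property :: "'a::boolean_algebra itself \<Rightarrow> 'p::preorder sentence"
  where "nikodym_property _ =
    (\<^bold>\<forall>\<mu> :: nat \<Rightarrow> ('a \<times> rat, 'p) name.
       (\<^bold>\<forall>n. ba_measure (\<mu> n)) \<^bold>\<and> pointwise_null \<mu> \<^bold>\<longrightarrow> weak_star_null \<mu>)"

end

theory Submission imports Defs begin

text \<open>
  In the ground model there are finitely additive measures \<open>\<nu> n\<close> of variation at most 2 and
  elements \<open>d n\<close> of the algebra such that \<open>\<nu> n a\<close> tends to 0 for every \<open>a\<close>, while \<open>\<nu> m (d n)\<close> is 1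
  for \<open>m = n\<close> and 0 otherwise. If \<open>f\<close> dominates the ground model, then \<open>f k\<close> is eventually beyond
  the point from which on \<open>\<bar>\<nu> n a\<bar> < 4 ^ - k\<close>, so the measures \<open>2 ^ k * \<nu> (f k)\<close> of the extension are
  pointwise null. They are not weak* null: all terms in the integral of the continuous function
  \<open>\<Sum>j. 2 ^ - j * \<chi> (d (f j))\<close> against the \<open>k\<close>-th measure are nonnegative and the \<open>k\<close>-th one is 1.

  In the forcing arguments one passes to conditions that decide finitely many values of \<open>f\<close>. The
  values of the measures are then ground model reals, and only that function and its integral are new.
\<close>

subsection \<open>Regular sentences\<close>

text \<open>The algebra lies in V, so each element a has its own threshold function in V, and one
  dominating real overtakes all of them at once; this is the only use of domination. The weights
  \<open>2 ^ k\<close> make the norms unbounded, which the uniform boundedness principle forbids for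
  a weak* null sequence. Rather than run that principle on a Banach space of names, the proof writes
  down one bad function. Its coefficients \<open>2 ^ - j\<close> are summable and cancel the weight
  at j = k, and \<open>4 ^ - k\<close> is so small that \<open>2 ^ k\<close> times it still tends to
  0. Biorthogonality, which is more than norms bounded away from 0, excludes cancellation even when
  f repeats a value. The obstacle is that the function involves all values of f, which no condition
  need decide: after J values it is known only up to the tail 2 / \<open>2 ^ J\<close>. Hence values
  of the measures are computed exactly (\<open>has_value\<close>), the function by enclosures
  (\<open>cut_between\<close>), and the integral by one-sided bounds
  (\<open>cut_ge\<close>).\<close>

definition regular :: "'p::preorder sentence \<Rightarrow> bool"
  where "regular \<phi> \<longleftrightarrow> (\<forall>p. \<phi> p \<longleftrightarrow> (\<forall>q\<le>p. \<exists>r\<le>q. \<phi> r))"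

named_theorems regular_intros

lemma regularD_mono: "regular \<phi> \<Longrightarrow> \<phi> p \<Longrightarrow> q \<le> p \<Longrightarrow> \<phi> q"
  unfolding regular_def by (meson order_trans)

text \<open>Sentences are arbitrary predicates on conditions; the regular ones are the regular open
  sets of the order. Only for these does truth densely below p give truth at p, which is the licence
  to pass to conditions that decide more.\<close>

lemma regularD_dense: "regular \<phi> \<Longrightarrow> (\<And>q. q \<le> p \<Longrightarrow> \<exists>r\<le>q. \<phi> r) \<Longrightarrow> \<phi> p"
  unfolding regular_def by blast

lemma regularI:
  assumes "\<And>p q. \<phi> p \<Longrightarrow> q \<le> p \<Longrightarrow> \<phi> q"
    and "\<And>p. (\<And>q. q \<le> p \<Longrightarrow> \<exists>r\<le>q. \<phi> r) \<Longrightarrow> \<phi> p"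
  shows "regular \<phi>"
  unfolding regular_def using assms by (metis order_refl)

lemma regular_dense_closure: "regular (\<lambda>p. \<forall>q\<le>p. \<exists>r\<le>q. \<psi> r)"
  unfolding regular_def by (meson order_trans order_refl)

lemma fEx_iff: "fEx \<Phi> p \<longleftrightarrow> (\<forall>q\<le>p. \<exists>r\<le>q. \<exists>x. \<Phi> x r)"
  unfolding fEx_def fNot_def fAll_def by blast

lemma fOr_iff: "fOr \<phi> \<psi> p \<longleftrightarrow> (\<forall>q\<le>p. \<exists>r\<le>q. \<phi> r \<or> \<psi> r)"
  by (auto simp: fOr_def fNot_def fAnd_def)

lemma fImp_iff: "fImp \<phi> \<psi> p \<longleftrightarrow> (\<forall>q\<le>p. \<phi> q \<longrightarrow> (\<exists>r\<le>q. \<psi> r))"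
  by (auto simp: fImp_def fNot_def fAnd_def)

lemma fNot_iff: "fNot \<phi> p \<longleftrightarrow> (\<forall>q\<le>p. \<not> \<phi> q)"
  by (simp add: fNot_def)

lemma fAnd_iff [simp]: "fAnd \<phi> \<psi> p \<longleftrightarrow> \<phi> p \<and> \<psi> p"
  by (simp add: fAnd_def)

lemma fAll_iff [simp]: "fAll \<Phi> p \<longleftrightarrow> (\<forall>x. \<Phi> x p)"
  by (simp add: fAll_def)

lemma ground_iff [simp]: "ground b p \<longleftrightarrow> b"
  by (simp add: ground_def)

lemma geq_iff: "geq x y p \<longleftrightarrow> x = y"
  by (simp add: geq_def)

lemma fImpI: "(\<And>q. q \<le> p \<Longrightarrow> \<phi> q \<Longrightarrow> \<psi> q) \<Longrightarrow> fImp \<phi> \<psi> p"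
  unfolding fImp_iff by (meson order_refl)

text \<open>Implication, being an abbreviation through negation, yields \<psi> only densely below
  conditions forcing \<phi>; regularity of \<psi> removes "densely".\<close>

lemma fImpD:
  assumes "fImp \<phi> \<psi> p" "regular \<phi>" "regular \<psi>" "q \<le> p" "\<phi> q"
  shows "\<psi> q"
proof (rule regularD_dense[OF assms(3)])
  fix r assume "r \<le> q"
  then have "r \<le> p" "\<phi> r" using assms(4) order_trans regularD_mono[OF assms(2,5)] by blast+
  then show "\<exists>s\<le>r. \<psi> s" using assms(1) unfolding fImp_iff by blast
qed

lemma fImpE: "fImp \<phi> \<psi> p \<Longrightarrow> \<phi> p \<Longrightarrow> (\<And>r. r \<le> p \<Longrightarrow> \<psi> r \<Longrightarrow> R) \<Longrightarrow> R"
  unfolding fImp_iff by (meson order_refl)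

lemma fExI: "(\<And>q. q \<le> p \<Longrightarrow> \<Phi> x q) \<Longrightarrow> fEx \<Phi> p"
  unfolding fEx_iff by (meson order_refl)

lemma fExE: "fEx \<Phi> p \<Longrightarrow> (\<And>x r. r \<le> p \<Longrightarrow> \<Phi> x r \<Longrightarrow> R) \<Longrightarrow> R"
  unfolding fEx_iff by (meson order_refl)

lemma fOrE: "fOr \<phi> \<psi> p \<Longrightarrow> (\<And>r. r \<le> p \<Longrightarrow> \<phi> r \<Longrightarrow> R) \<Longrightarrow> (\<And>r. r \<le> p \<Longrightarrow> \<psi> r \<Longrightarrow> R) \<Longrightarrow> R"
  unfolding fOr_iff by (meson order_refl)

lemma fIff_iff:
  assumes "regular \<phi>" "regular \<psi>"
  shows "fIff \<phi> \<psi> p \<longleftrightarrow> (\<forall>q\<le>p. \<phi> q \<longleftrightarrow> \<psi> q)"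
  unfolding fIff_def fAnd_iff
  using fImpD[OF _ assms, of p] fImpD[OF _ assms(2,1), of p] fImpI[of p \<phi> \<psi>] fImpI[of p \<psi> \<phi>]
  by blast

lemma fAllI: "(\<And>x. \<Phi> x p) \<Longrightarrow> fAll \<Phi> p"
  by simp

lemma fAllD: "fAll \<Phi> p \<Longrightarrow> \<Phi> x p"
  by simp

lemma fAndI: "\<phi> p \<Longrightarrow> \<psi> p \<Longrightarrow> fAnd \<phi> \<psi> p"
  by simp

lemma fImpI_dense: "(\<And>q. q \<le> p \<Longrightarrow> \<phi> q \<Longrightarrow> \<exists>r\<le>q. \<psi> r) \<Longrightarrow> fImp \<phi> \<psi> p"
  by (simp add: fImp_iff)

lemma fExI_dense: "(\<And>q. q \<le> p \<Longrightarrow> \<exists>r\<le>q. \<exists>x. \<Phi> x r) \<Longrightarrow> fEx \<Phi> p"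
  by (simp add: fEx_iff)

lemma fImp_regular_iff:
  "regular \<phi> \<Longrightarrow> regular \<psi> \<Longrightarrow> fImp \<phi> \<psi> p \<longleftrightarrow> (\<forall>q\<le>p. \<phi> q \<longrightarrow> \<psi> q)"
  using fImpD fImpI by metis

lemma regular_ground [regular_intros]: "regular (ground b)"
  unfolding regular_def by (auto intro: order_refl)

lemma regular_fNot [regular_intros]:
  assumes "regular \<phi>" shows "regular (fNot \<phi>)"
proof (rule regularI)
  show "fNot \<phi> q" if "fNot \<phi> p" "q \<le> p" for p q
    using that order_trans unfolding fNot_def by blast
  show "fNot \<phi> p" if *: "\<And>q. q \<le> p \<Longrightarrow> \<exists>r\<le>q. fNot \<phi> r" for p
    unfolding fNot_def
  proof (intro allI impI notI)
    fix q assume "q \<le> p" "\<phi> q"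
    with * obtain r where "r \<le> q" "fNot \<phi> r" by blast
    with regularD_mono[OF assms \<open>\<phi> q\<close>] show False unfolding fNot_def by (meson order_refl)
  qed
qed

lemma regular_fAnd [regular_intros]: "regular \<phi> \<Longrightarrow> regular \<psi> \<Longrightarrow> regular (fAnd \<phi> \<psi>)"
  by (rule regularI) (auto intro: regularD_mono regularD_dense)

lemma regular_fAll [regular_intros]: "(\<And>x. regular (\<Phi> x)) \<Longrightarrow> regular (fAll \<Phi>)"
  by (rule regularI) (auto intro: regularD_mono, metis regularD_dense)

lemma regular_fOr [regular_intros]: "regular (fOr \<phi> \<psi>)"
  using regular_dense_closure[of "\<lambda>r. \<phi> r \<or> \<psi> r"] by (simp add: fOr_iff[abs_def])

lemma regular_fEx [regular_intros]: "regular (fEx \<Phi>)"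
  using regular_dense_closure[of "\<lambda>r. \<exists>x. \<Phi> x r"] by (simp add: fEx_iff[abs_def])

lemma regular_fImp [regular_intros]:
  assumes "regular \<phi>" shows "regular (fImp \<phi> \<psi>)"
proof (rule regularI)
  show "fImp \<phi> \<psi> q" if "fImp \<phi> \<psi> p" "q \<le> p" for p q
    using that order_trans unfolding fImp_iff by blast
  show "fImp \<phi> \<psi> p" if *: "\<And>q. q \<le> p \<Longrightarrow> \<exists>r\<le>q. fImp \<phi> \<psi> r" for p
    unfolding fImp_iff
  proof (intro allI impI)
    fix q assume "q \<le> p" "\<phi> q"
    with * obtain r where "r \<le> q" "fImp \<phi> \<psi> r" by blast
    moreover have "\<phi> r" using regularD_mono[OF assms \<open>\<phi> q\<close> \<open>r \<le> q\<close>] .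
    ultimately obtain s where "s \<le> r" "\<psi> s" unfolding fImp_iff by (meson order_refl)
    then show "\<exists>s\<le>q. \<psi> s" using order_trans \<open>r \<le> q\<close> by blast
  qed
qed

lemma regular_fIff [regular_intros]: "regular \<phi> \<Longrightarrow> regular \<psi> \<Longrightarrow> regular (fIff \<phi> \<psi>)"
  unfolding fIff_def by (intro regular_intros)

lemma regular_mem [regular_intros]: "regular (mem E x \<tau>)"
  unfolding mem_def by (rule regular_dense_closure)

lemma regular_app [regular_intros]: "regular (app E F s q)"
  unfolding app_def by (rule regular_mem)

lemma regular_radd [regular_intros]: "regular (radd x y q)"
  unfolding radd_def by (rule regular_fEx)

lemma regular_req [regular_intros]:
  "(\<And>q. regular (x q)) \<Longrightarrow> (\<And>q. regular (y q)) \<Longrightarrow> regular (req x y)"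
  unfolding req_def by (intro regular_intros)

lemma regular_ultrafilter [regular_intros]: "regular (ultrafilter U)"
  unfolding ultrafilter_def by (intro regular_intros)

lemma regular_pmem [regular_intros]: "regular (pmem U B)"
  unfolding pmem_def by (intro regular_intros)

lemma regular_ba_measure [regular_intros]: "regular (ba_measure \<mu>)"
  unfolding ba_measure_def real_fun_on_def by (intro regular_intros)

lemma regular_rless [regular_intros]: "regular (rless x y)"
  unfolding rless_def by (rule regular_fEx)

lemma regular_extends_measure: "regular (extends_measure m \<mu>)"
  unfolding extends_measure_def by (intro regular_intros)

lemma seteq_iff: "seteq E \<sigma> \<tau> p \<longleftrightarrow> (\<forall>x. \<forall>q\<le>p. mem E x \<sigma> q \<longleftrightarrow> mem E x \<tau> q)"
  by (simp add: seteq_def fIff_iff regular_mem)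

lemma seteq_refl: "seteq E \<sigma> \<sigma> p"
  by (simp add: seteq_iff)

text \<open>A class of names becomes a name by pairing each y with all conditions forcing
  \<open>\<Psi> y\<close>. Membership is then forced exactly where \<Psi> is, because \<Psi>
  respects the forced equality E. Both \<open>clopen\<close> and \<open>phi\<close> are built this
  way.\<close>

lemma mem_Collect:
  assumes "regular (\<Psi> x)" "\<And>y p q. \<Psi> y p \<Longrightarrow> q \<le> p \<Longrightarrow> \<Psi> y q"
    and "\<And>y r. E x y r \<Longrightarrow> \<Psi> y r \<Longrightarrow> \<Psi> x r" "\<And>r. E x x r"
  shows "mem E x {(y, s). \<Psi> y s} p \<longleftrightarrow> \<Psi> x p"
proof
  assume m: "mem E x {(y, s). \<Psi> y s} p"
  show "\<Psi> x p"
  proof (rule regularD_dense[OF assms(1)])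
    fix q assume "q \<le> p"
    with m obtain r y s where "r \<le> q" "\<Psi> y s" "r \<le> s" "E x y r"
      unfolding mem_def by auto
    then show "\<exists>r\<le>q. \<Psi> x r" using assms(2,3) by blast
  qed
next
  assume "\<Psi> x p"
  then show "mem E x {(y, s). \<Psi> y s} p"
    unfolding mem_def using assms(2,4) by (auto intro!: exI)
qed

subsection \<open>Sentences decided by a condition\<close>

text \<open>Below p such a sentence behaves like a classical truth value, so a formula with decided
  atoms can be evaluated in HOL connective by connective.\<close>

definition decided :: "'p::preorder sentence \<Rightarrow> bool \<Rightarrow> 'p \<Rightarrow> bool"
  where "decided \<phi> b p \<longleftrightarrow> (\<forall>q\<le>p. \<phi> q \<longleftrightarrow> b)"

lemma decidedD: "decided \<phi> b p \<Longrightarrow> q \<le> p \<Longrightarrow> \<phi> q \<longleftrightarrow> b"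
  by (simp add: decided_def)

lemma decided_mono: "decided \<phi> b p \<Longrightarrow> q \<le> p \<Longrightarrow> decided \<phi> b q"
  unfolding decided_def by (meson order_trans)

named_theorems decided_intros

lemma decided_ground [decided_intros]: "decided (ground b) b p"
  by (simp add: decided_def)

lemma decided_fNot [decided_intros]: "decided \<phi> b p \<Longrightarrow> decided (fNot \<phi>) (\<not> b) p"
  unfolding decided_def fNot_def by (meson order_trans order_refl)

lemma decided_fAnd [decided_intros]:
  "decided \<phi> b p \<Longrightarrow> decided \<psi> c p \<Longrightarrow> decided (fAnd \<phi> \<psi>) (b \<and> c) p"
  by (simp add: decided_def)

lemma decided_fAll [decided_intros]:
  "(\<And>x. decided (\<Phi> x) (b x) p) \<Longrightarrow> decided (fAll \<Phi>) (\<forall>x. b x) p"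
  by (simp add: decided_def)

lemma decided_fOr [decided_intros]:
  assumes "decided \<phi> b p" "decided \<psi> c p" shows "decided (fOr \<phi> \<psi>) (b \<or> c) p"
proof -
  have "decided (fOr \<phi> \<psi>) (\<not> (\<not> b \<and> \<not> c)) p"
    unfolding fOr_def by (intro decided_intros assms)
  then show ?thesis by simp
qed

lemma decided_fImp [decided_intros]:
  assumes "decided \<phi> b p" "decided \<psi> c p" shows "decided (fImp \<phi> \<psi>) (b \<longrightarrow> c) p"
proof -
  have "decided (fImp \<phi> \<psi>) (\<not> (b \<and> \<not> c)) p"
    unfolding fImp_def by (intro decided_intros assms)
  then show ?thesis by simp
qed

lemma decided_fIff [decided_intros]:
  assumes "decided \<phi> b p" "decided \<psi> c p" shows "decided (fIff \<phi> \<psi>) (b \<longleftrightarrow> c) p"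
proof -
  have "decided (fIff \<phi> \<psi>) ((b \<longrightarrow> c) \<and> (c \<longrightarrow> b)) p"
    unfolding fIff_def by (intro decided_intros assms)
  then show ?thesis by (simp add: iff_conv_conj_imp)
qed

lemma decided_fEx [decided_intros]:
  assumes "\<And>x. decided (\<Phi> x) (b x) p" shows "decided (fEx \<Phi>) (\<exists>x. b x) p"
proof -
  have "decided (fEx \<Phi>) (\<not> (\<forall>x. \<not> b x)) p"
    unfolding fEx_def by (intro decided_intros assms)
  then show ?thesis by simp
qed

text \<open>Below p the cut is that of the ground model real v; arithmetic of cuts then reduces to
  real arithmetic.\<close>

definition has_value :: "'p::preorder cut \<Rightarrow> real \<Rightarrow> 'p \<Rightarrow> bool"
  where "has_value x v p \<longleftrightarrow> (\<forall>q. decided (x q) (of_rat q < v) p)"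

lemma has_value_decided [decided_intros]: "has_value x v p \<Longrightarrow> decided (x q) (of_rat q < v) p"
  by (simp add: has_value_def)

lemma has_valueI: "(\<And>q. decided (x q) (b q) p) \<Longrightarrow> (\<And>q. b q \<longleftrightarrow> of_rat q < v) \<Longrightarrow> has_value x v p"
  by (simp add: has_value_def)

lemma has_value_mono: "has_value x v p \<Longrightarrow> q \<le> p \<Longrightarrow> has_value x v q"
  unfolding has_value_def using decided_mono by blast

lemma has_value_rconst: "has_value (rconst c) (of_rat c) p"
  by (simp add: has_value_def decided_def rconst_def of_rat_less)

lemma has_value_rminus:
  assumes "has_value x v p" shows "has_value (rminus x) (- v) p"
proof (rule has_valueI)
  show "decided (rminus x q) (\<exists>a. \<not> of_rat a < v \<and> q < - a) p" for q
    unfolding rminus_def by (intro decided_intros assms)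
  fix q
  show "(\<exists>a. \<not> of_rat a < v \<and> q < - a) \<longleftrightarrow> of_rat q < - v"
  proof
    assume "\<exists>a. \<not> of_rat a < v \<and> q < - a"
    then obtain a where a: "v \<le> of_rat a" "q < - a" by (auto simp: not_less)
    from a(2) have "(of_rat q :: real) < of_rat (- a)" by (simp only: of_rat_less)
    with a(1) show "of_rat q < - v" by (simp add: of_rat_minus)
  next
    assume "of_rat q < - v"
    then obtain a where a: "v < of_rat a" "of_rat a < - (of_rat q :: real)"
      using of_rat_dense[of v "- of_rat q"] by (auto simp: less_minus_iff)
    then have "(of_rat q :: real) < of_rat (- a)" by (simp add: of_rat_minus)
    then have "q < - a" by (simp only: of_rat_less)
    with a show "\<exists>a. \<not> of_rat a < v \<and> q < - a" by (intro exI[of _ a]) auto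
  qed
qed

lemma has_value_radd:
  assumes "has_value x v p" "has_value y w p" shows "has_value (radd x y) (v + w) p"
proof (rule has_valueI)
  show "decided (radd x y q) (\<exists>a b. of_rat a < v \<and> of_rat b < w \<and> q = a + b) p" for q
    unfolding radd_def by (intro decided_intros assms)
  fix q
  show "(\<exists>a b. of_rat a < v \<and> of_rat b < w \<and> q = a + b) \<longleftrightarrow> of_rat q < v + w"
  proof
    assume "of_rat q < v + w"
    then obtain a where a: "of_rat q - w < of_rat a" "of_rat a < v"
      using of_rat_dense[of "of_rat q - w" v] by auto
    then have "of_rat (q - a) < w" by (simp add: of_rat_diff)
    with a show "\<exists>a b. of_rat a < v \<and> of_rat b < w \<and> q = a + b"
      by (intro exI[of _ a] exI[of _ "q - a"]) auto
  qed (auto simp: of_rat_add)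
qed

lemma has_value_rabs:
  assumes "has_value x v p" shows "has_value (rabs x) \<bar>v\<bar> p"
proof (rule has_valueI)
  show "decided (rabs x q) (of_rat q < v \<or> of_rat q < - v) p" for q
    unfolding rabs_def by (intro decided_intros assms has_value_rminus)
qed auto

lemma has_value_rsum:
  assumes "\<And>a. a \<in> set as \<Longrightarrow> has_value (X a) (v a) p"
  shows "has_value (rsum (map X as)) (\<Sum>a\<leftarrow>as. v a) p"
  using assms
proof (induction as)
  case Nil
  then show ?case using has_value_rconst[of 0 p] by (simp add: rsum_def)
next
  case (Cons a as)
  then show ?case using has_value_radd[of "X a" "v a" p "rsum (map X as)" "\<Sum>a\<leftarrow>as. v a"]
    by (simp add: rsum_def)
qed

lemma has_value_is_real:
  assumes "has_value x v p" shows "is_real x p"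
proof -
  have "decided (is_real x) ((\<exists>q. of_rat q < v) \<and> (\<exists>q. \<not> of_rat q < v) \<and>
     (\<forall>q r. r < q \<and> of_rat q < v \<longrightarrow> of_rat r < v) \<and>
     (\<forall>q. of_rat q < v \<longrightarrow> (\<exists>r. q < r \<and> of_rat r < v))) p"
    unfolding is_real_def by (intro decided_intros assms)
  moreover have "\<exists>q. of_rat q < v" using of_rat_dense[of "v - 1" v] by auto
  moreover have "\<exists>q. \<not> of_rat q < v" using of_rat_dense[of v "v + 1"] by (auto simp: not_less intro: less_imp_le)
  moreover have "\<forall>q r. r < q \<and> of_rat q < v \<longrightarrow> of_rat r < v"
    by (meson less_trans of_rat_less)
  moreover have "\<forall>q. of_rat q < v \<longrightarrow> (\<exists>r. q < r \<and> of_rat r < v)"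
    using of_rat_dense of_rat_less by blast
  ultimately show ?thesis by (auto dest: decidedD[OF _ order_refl])
qed

lemma has_value_req:
  assumes "has_value x v p" "has_value y v p" shows "req x y p"
proof -
  have "decided (req x y) (\<forall>q. of_rat q < v \<longleftrightarrow> of_rat q < v) p"
    unfolding req_def by (intro decided_intros assms)
  then show ?thesis by (auto dest: decidedD[OF _ order_refl])
qed

lemma has_value_rle:
  assumes "has_value x v p" "has_value y w p" "v \<le> w" shows "rle x y p"
proof -
  have "decided (rle x y) (\<forall>q. of_rat q < v \<longrightarrow> of_rat q < w) p"
    unfolding rle_def by (intro decided_intros assms)
  with assms(3) show ?thesis by (auto dest: decidedD[OF _ order_refl])
qed

lemma has_value_rless:
  assumes "has_value x v p" "has_value y w p" "v < w" shows "rless x y p"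
proof -
  have "decided (rless x y) (\<exists>q. \<not> of_rat q < v \<and> of_rat q < w) p"
    unfolding rless_def by (intro decided_intros assms)
  moreover have "\<exists>q. \<not> of_rat q < v \<and> of_rat q < w"
    using of_rat_dense[OF assms(3)] by (auto simp: not_less intro: less_imp_le)
  ultimately show ?thesis by (auto dest: decidedD[OF _ order_refl])
qed

lemma req_has_value:
  assumes "req x y p" "has_value y v p" "\<And>q. regular (x q)" "\<And>q. regular (y q)"
  shows "has_value x v p"
  using assms unfolding req_def has_value_def decided_def by (auto simp: fIff_iff)

subsection \<open>Estimates for cuts\<close>

lemma raddI:
  assumes "\<And>s. s \<le> p \<Longrightarrow> x a s" "\<And>s. s \<le> p \<Longrightarrow> y b s" "q = a + b"
  shows "radd x y q p"
  unfolding radd_def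
proof (rule fExI, rule fExI)
  fix s t assume "s \<le> p" "t \<le> s"
  then have "t \<le> p" using order_trans by blast
  then show "(x a \<^bold>\<and> y b \<^bold>\<and> ground (q = a + b)) t" using assms by simp
qed

lemma rminusI:
  assumes "\<And>s. s \<le> p \<Longrightarrow> \<not> x a s" "q < - a"
  shows "rminus x q p"
  unfolding rminus_def
proof (rule fExI)
  fix s assume "s \<le> p"
  then have "\<not> x a t" if "t \<le> s" for t using that assms(1) order_trans by blast
  then show "((\<^bold>\<not> x a) \<^bold>\<and> ground (q < - a)) s" using assms(2) by (simp add: fNot_iff)
qed

text \<open>One-sided substitute for \<open>has_value\<close>: a new real such as the integral need
  not equal a ground model real below any condition, but lower bounds add up and suffice for the
  contradiction.\<close>

definition cut_ge :: "'p::preorder cut \<Rightarrow> real \<Rightarrow> 'p \<Rightarrow> bool"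
  where "cut_ge x v p \<longleftrightarrow> (\<forall>q. of_rat q < v \<longrightarrow> (\<forall>r\<le>p. x q r))"

lemma has_value_cut_ge: "has_value x v p \<Longrightarrow> cut_ge x v p"
  by (simp add: has_value_def decided_def cut_ge_def)

lemma cut_ge_radd:
  assumes "cut_ge x v p" "cut_ge y w p" shows "cut_ge (radd x y) (v + w) p"
  unfolding cut_ge_def
proof (intro allI impI)
  fix q r assume "of_rat q < v + w" "r \<le> p"
  then obtain a where a: "of_rat q - w < of_rat a" "of_rat a < v"
    using of_rat_dense[of "of_rat q - w" v] by auto
  then have "of_rat (q - a) < w" by (simp add: of_rat_diff)
  with a assms have "x a s" "y (q - a) s" if "s \<le> p" for s
    using that unfolding cut_ge_def by blast+
  then have "radd x y q p" by (intro raddI[where a = a and b = "q - a"]) auto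
  then show "radd x y q r" using regularD_mono[OF regular_radd] \<open>r \<le> p\<close> by blast
qed

lemma cut_ge_rsum:
  assumes "\<And>a. a \<in> set as \<Longrightarrow> cut_ge (X a) (v a) p"
  shows "cut_ge (rsum (map X as)) (\<Sum>a\<leftarrow>as. v a) p"
  using assms
proof (induction as)
  case Nil
  then show ?case using has_value_cut_ge[OF has_value_rconst[of 0 p]] by (simp add: rsum_def)
next
  case (Cons a as)
  then show ?case using cut_ge_radd[of "X a" "v a" p "rsum (map X as)" "\<Sum>a\<leftarrow>as. v a"]
    by (simp add: rsum_def)
qed

lemma product_lower_bound_near:
  fixes c v :: real
  assumes "q < c * v"
  shows "\<exists>\<eta>>0. \<forall>a d. \<bar>a - c\<bar> < \<eta> \<longrightarrow> \<bar>d - v\<bar> < \<eta> \<longrightarrow> q < a * d"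
proof -
  have "((\<lambda>z. fst z * snd z) \<longlongrightarrow> c * v) (nhds c \<times>\<^sub>F nhds v)"
    by (rule tendsto_mult_Pair)
  then have "\<forall>\<^sub>F z in nhds c \<times>\<^sub>F nhds v. q < fst z * snd z"
    using assms by (rule order_tendstoD(1))
  then obtain P Q where P: "\<forall>\<^sub>F x in nhds c. P x" "\<forall>\<^sub>F x in nhds v. Q x"
      and PQ: "\<And>x y. P x \<Longrightarrow> Q y \<Longrightarrow> q < x * y"
    unfolding eventually_prod_filter by auto
  from P(1) obtain d1 where d1: "d1 > 0" "\<And>x. dist x c < d1 \<Longrightarrow> P x"
    unfolding eventually_nhds_metric by blast
  from P(2) obtain d2 where d2: "d2 > 0" "\<And>x. dist x v < d2 \<Longrightarrow> Q x"
    unfolding eventually_nhds_metric by blast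
  show ?thesis
    by (rule exI[of _ "min d1 d2"]) (use d1 d2 PQ in \<open>auto simp: dist_real_def\<close>)
qed

text \<open>By continuity of multiplication, rational intervals close enough around c and v have all
  four corner products above q; c is the upper end point of its own interval.\<close>

lemma cut_ge_rmult_rconst:
  assumes "has_value y v p" shows "cut_ge (rmult (rconst c) y) (of_rat c * v) p"
  unfolding cut_ge_def
proof (intro allI impI)
  fix q r assume q: "of_rat q < of_rat c * v" and "r \<le> p"
  obtain \<eta> :: real where \<eta>: "\<eta> > 0"
    "\<And>a d. \<bar>a - of_rat c\<bar> < \<eta> \<Longrightarrow> \<bar>d - v\<bar> < \<eta> \<Longrightarrow> of_rat q < a * d"
    using product_lower_bound_near[OF q] by auto
  obtain a where a: "of_rat c - \<eta> < of_rat a" "of_rat a < (of_rat c :: real)"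
    using of_rat_dense[of "of_rat c - \<eta>" "of_rat c"] \<eta>(1) by auto
  obtain e where e: "v - \<eta> < of_rat e" "of_rat e < v"
    using of_rat_dense[of "v - \<eta>" v] \<eta>(1) by auto
  obtain d where d: "v < of_rat d" "of_rat d < v + \<eta>"
    using of_rat_dense[of v "v + \<eta>"] \<eta>(1) by auto
  have less: "q < x * y" if "\<bar>of_rat x - of_rat c\<bar> < \<eta>" "\<bar>of_rat y - v\<bar> < \<eta>" for x y
  proof -
    have "(of_rat q :: real) < of_rat (x * y)" using \<eta>(2)[OF that] by (simp add: of_rat_mult)
    then show ?thesis by (simp only: of_rat_less)
  qed
  have "q < a * e \<and> q < a * d \<and> q < c * e \<and> q < c * d"
    by (intro conjI less) (use a d e \<eta>(1) in auto)
  moreover have "a < c" using a(2) by (simp add: of_rat_less)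
  moreover have "\<And>r. r \<le> p \<Longrightarrow> y e r" "\<And>r. r \<le> p \<Longrightarrow> \<not> y d r"
    using assms d e unfolding has_value_def decided_def by auto
  ultimately have body: "(rconst c a \<^bold>\<and> \<^bold>\<not> rconst c c \<^bold>\<and> y e \<^bold>\<and> \<^bold>\<not> y d \<^bold>\<and>
      ground (q < a * e \<and> q < a * d \<and> q < c * e \<and> q < c * d)) s" if "s \<le> p" for s
    using that order_trans[OF _ that] by (simp add: fNot_iff rconst_def)
  have "rmult (rconst c) y q p"
    unfolding rmult_def
    by (rule fExI[where x = a], rule fExI[where x = c], rule fExI[where x = e],
      rule fExI[where x = d], rule body) (blast dest: order_trans)
  then show "rmult (rconst c) y q r"
    using \<open>r \<le> p\<close> regularD_mono[OF regular_fEx] unfolding rmult_def by blast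
qed

text \<open>A rational witnessing that the absolute value is below \<epsilon> lies at or above x,
  hence at or above v. The conclusion is about ground model reals, so a forced inequality can
  produce an outright contradiction.\<close>

lemma cut_ge_rless_rabs:
  assumes "cut_ge x v p" "rless (rabs x) (rconst \<epsilon>) p"
  shows "v < of_rat \<epsilon>"
  using assms(2) unfolding rless_def
proof (rule fExE)
  fix q r assume *: "r \<le> p" "((\<^bold>\<not> rabs x q) \<^bold>\<and> rconst \<epsilon> q) r"
  then have "\<not> rabs x q r" "q < \<epsilon>" by (auto simp: fNot_iff rconst_def)
  then obtain s where s: "s \<le> r" "\<And>t. t \<le> s \<Longrightarrow> \<not> x q t"
    unfolding rabs_def fOr_iff by blast
  then have "\<not> x q s" "s \<le> p" using *(1) by (auto intro: order_trans)
  then have "\<not> of_rat q < v"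
    using assms(1) unfolding cut_ge_def by blast
  moreover have "(of_rat q :: real) < of_rat \<epsilon>" using \<open>q < \<epsilon>\<close> by (simp add: of_rat_less)
  ultimately show ?thesis by simp
qed

text \<open>A stronger condition picks the rational q that separates the absolute value from
  \<epsilon>; then x is at most q, which is recorded as a lower bound of -x.\<close>

lemma rless_rabs_cut_ge_rminus:
  assumes "rless (rabs x) (rconst \<epsilon>) p" "\<And>q. regular (x q)"
  obtains q r where "r \<le> p" "q < \<epsilon>" "cut_ge (rminus x) (- of_rat q) r"
  using assms(1) unfolding rless_def
proof (rule fExE)
  fix q r assume *: "r \<le> p" "((\<^bold>\<not> rabs x q) \<^bold>\<and> rconst \<epsilon> q) r"
  have no: "\<not> x q r'" if "r' \<le> r" for r'
  proof
    assume "x q r'"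
    then have "rabs x q r'"
      unfolding rabs_def fOr_iff using regularD_mono[OF assms(2)] by (meson order_refl)
    then show False using * that by (auto simp: fNot_iff)
  qed
  have "cut_ge (rminus x) (- of_rat q) r"
    unfolding cut_ge_def
  proof (intro allI impI)
    fix a s assume "of_rat a < - (of_rat q :: real)" "s \<le> r"
    then have "a < - q" by (simp flip: of_rat_minus add: of_rat_less)
    moreover have "\<not> x q t" if "t \<le> s" for t
      using no order_trans[OF that \<open>s \<le> r\<close>] by blast
    ultimately show "rminus x a s" by (rule rminusI[rotated])
  qed
  then show thesis using * by (intro that[of r q]) (auto simp: rconst_def)
qed

text \<open>Forces c \<le> x \<le> c + t, the precision to which finitely many values of f determine
  a function that depends on all of them.\<close>

definition cut_between :: "'p::preorder cut \<Rightarrow> rat \<Rightarrow> rat \<Rightarrow> 'p \<Rightarrow> bool"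
  where "cut_between x c t p \<longleftrightarrow> (\<forall>q. \<forall>r\<le>p. (q < c \<longrightarrow> x q r) \<and> (x q r \<longrightarrow> q < c + t))"

lemma cut_between_mono: "cut_between x c t p \<Longrightarrow> q \<le> p \<Longrightarrow> cut_between x c t q"
  unfolding cut_between_def by (meson order_trans)

lemma cut_between_rconst: "0 \<le> t \<Longrightarrow> cut_between (rconst c) c t p"
  by (auto simp: cut_between_def rconst_def)

lemma cut_between_rdiff:
  assumes x: "cut_between x c t p" and y: "cut_between y c t p" and "rabs (rdiff x y) q p"
  shows "q < t"
  using assms(3) unfolding rabs_def
proof (rule fOrE)
  fix r assume r: "r \<le> p" "rdiff x y q r"
  then obtain a b r' where r': "r' \<le> r" "x a r'" "rminus y b r'" "q = a + b"
    unfolding rdiff_def radd_def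
    by (elim fExE) (simp, blast intro: order_trans)
  then obtain a' r'' where r'': "r'' \<le> r'" "(\<^bold>\<not> y a') r''" "b < - a'"
    unfolding rminus_def by (elim fExE) auto
  have le: "r' \<le> p" "r'' \<le> p" using r r' r'' order_trans by blast+
  then have "a < c + t" using x r'(2) unfolding cut_between_def by blast
  moreover have "\<not> y a' r''" using r''(2) by (auto simp: fNot_iff)
  then have "\<not> a' < c" using y le unfolding cut_between_def by blast
  ultimately show "q < t" using r' r'' by auto
next
  fix r assume r: "r \<le> p" "rminus (rdiff x y) q r"
  then obtain a r' where r': "r' \<le> r" "(\<^bold>\<not> rdiff x y a) r'" "q < - a"
    unfolding rminus_def by (elim fExE) auto
  have "rdiff x y a r'" if "a < - t"
  proof -
    \<comment> \<open>The gap a + t < 0 is halved, so that both summands fall strictly below their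
      targets: c + u < c \<le> x and -c - t + u < -c - t \<le> -y.\<close>
    define u where "u = (a + t) / 2"
    have u: "u < 0" "a = (c + u) + (- c - t + u)" using that by (auto simp: u_def field_simps)
    have le: "s \<le> p" if "s \<le> r'" for s using that r r' order_trans by blast
    have "x (c + u) s" if "s \<le> r'" for s
      using x le[OF that] u(1) unfolding cut_between_def by auto
    moreover have "rminus y (- c - t + u) s" if "s \<le> r'" for s
    proof -
      have "\<not> y (c + t) s'" if "s' \<le> s" for s'
        using y le order_trans[OF \<open>s' \<le> s\<close> \<open>s \<le> r'\<close>] unfolding cut_between_def by blast
      then show ?thesis using u(1) by (intro rminusI[where a = "c + t"]) auto
    qed
    ultimately show ?thesis
      unfolding rdiff_def using u(2) by (intro raddI[where a = "c + u" and b = "- c - t + u"]) auto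
  qed
  with r' have "\<not> a < - t" by (auto simp: fNot_iff)
  with r' show "q < t" by simp
qed

subsection \<open>Ultrafilters on Boolean algebras\<close>

definition proper_filter :: "'a::boolean_algebra set \<Rightarrow> bool"
  where "proper_filter F \<longleftrightarrow> top \<in> F \<and> bot \<notin> F \<and> (\<forall>a\<in>F. \<forall>b\<in>F. inf a b \<in> F) \<and>
    (\<forall>a\<in>F. \<forall>b. a \<le> b \<longrightarrow> b \<in> F)"

text \<open>Ultrafilters of the ground model, which carry the point masses in \<nu>; the points of
  the Stone space of the extension satisfy \<open>ultrafilter\<close> instead.\<close>

definition ultra :: "'a::boolean_algebra set \<Rightarrow> bool"
  where "ultra U \<longleftrightarrow> proper_filter U \<and> (\<forall>a. a \<in> U \<or> - a \<in> U)"

lemma proper_filter_inf: "proper_filter F \<Longrightarrow> a \<in> F \<Longrightarrow> b \<in> F \<Longrightarrow> inf a b \<in> F"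
  unfolding proper_filter_def by blast

lemma proper_filter_mono: "proper_filter F \<Longrightarrow> a \<in> F \<Longrightarrow> a \<le> b \<Longrightarrow> b \<in> F"
  unfolding proper_filter_def by blast

lemma ultra_mono: "ultra U \<Longrightarrow> a \<in> U \<Longrightarrow> a \<le> b \<Longrightarrow> b \<in> U"
  unfolding ultra_def proper_filter_def by blast

lemma ultra_top: "ultra U \<Longrightarrow> top \<in> U"
  unfolding ultra_def proper_filter_def by blast

lemma ultra_bot: "ultra U \<Longrightarrow> bot \<notin> U"
  unfolding ultra_def proper_filter_def by blast

lemma ultra_inf: "ultra U \<Longrightarrow> inf a b \<in> U \<longleftrightarrow> a \<in> U \<and> b \<in> U"
  using ultra_mono[of U "inf a b" a] ultra_mono[of U "inf a b" b]
  unfolding ultra_def proper_filter_def by (meson inf_le1 inf_le2)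

lemma ultra_compl: "ultra U \<Longrightarrow> - a \<in> U \<longleftrightarrow> a \<notin> U"
  using ultra_inf[of U a "- a"] ultra_bot[of U] unfolding ultra_def inf_compl_bot by blast

lemma ultra_sup:
  assumes "ultra U" shows "sup a b \<in> U \<longleftrightarrow> a \<in> U \<or> b \<in> U"
proof -
  have "- sup a b \<in> U \<longleftrightarrow> - a \<in> U \<and> - b \<in> U"
    unfolding compl_sup by (rule ultra_inf[OF assms])
  then show ?thesis unfolding ultra_compl[OF assms] by blast
qed

lemma ultra_disjoint: "ultra U \<Longrightarrow> inf a b = bot \<Longrightarrow> a \<in> U \<Longrightarrow> b \<notin> U"
  using ultra_inf[of U a b] ultra_bot[of U] by auto

lemma proper_filter_extends_ultra:
  fixes F :: "'a::boolean_algebra set"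
  assumes "proper_filter F"
  shows "\<exists>U. ultra U \<and> F \<subseteq> U"
proof -
  let ?A = "{G. proper_filter G \<and> F \<subseteq> G}"
  have "\<exists>M\<in>?A. \<forall>X\<in>?A. M \<subseteq> X \<longrightarrow> X = M"
  proof (rule subset_Zorn_nonempty)
    show "?A \<noteq> {}" using assms by blast
  next
    fix C assume C: "C \<noteq> {}" "subset.chain ?A C"
    have ch: "G \<in> ?A" if "G \<in> C" for G using C that unfolding subset.chain_def by blast
    have "proper_filter (\<Union>C)"
      unfolding proper_filter_def
    proof (intro conjI ballI allI impI)
      show "top \<in> \<Union>C" using C(1) ch unfolding proper_filter_def by fastforce
      show "bot \<notin> \<Union>C" using ch unfolding proper_filter_def by blast
    next
      fix a b assume "a \<in> \<Union>C" "b \<in> \<Union>C"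
      then obtain G H where GH: "G \<in> C" "a \<in> G" "H \<in> C" "b \<in> H" by blast
      then have "G \<subseteq> H \<or> H \<subseteq> G" using C(2) unfolding subset.chain_def by blast
      then obtain K where "K \<in> C" "a \<in> K" "b \<in> K" using GH by blast
      then show "inf a b \<in> \<Union>C" using proper_filter_inf[of K a b] ch[of K] by blast
    next
      fix a b assume "a \<in> \<Union>C" "a \<le> b"
      then obtain K where "K \<in> C" "a \<in> K" by blast
      then show "b \<in> \<Union>C" using proper_filter_mono[of K a b] ch[of K] \<open>a \<le> b\<close> by blast
    qed
    then show "\<Union>C \<in> ?A" using C(1) ch by blast
  qed
  then obtain M where M: "proper_filter M" "F \<subseteq> M"
      and max: "\<And>X. proper_filter X \<Longrightarrow> M \<subseteq> X \<Longrightarrow> X = M"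
    by (auto; metis subset_trans)
  have "a \<in> M \<or> - a \<in> M" for a
  proof (rule ccontr)
    assume no: "\<not> (a \<in> M \<or> - a \<in> M)"
    \<comment> \<open>The filter generated by M and a: it is proper because -a is not in M, so
      maximality puts a into M.\<close>
    let ?G = "{b. \<exists>m\<in>M. inf m a \<le> b}"
    have top: "top \<in> M" using M unfolding proper_filter_def by blast
    have "bot \<notin> ?G"
    proof
      assume "bot \<in> ?G"
      then obtain m where m: "m \<in> M" "inf m a = bot" by (auto simp: bot_unique)
      then have "m \<le> - a" by (simp add: inf_shunt)
      with m no show False using proper_filter_mono[OF M(1)] by blast
    qed
    moreover have "inf b c \<in> ?G" if "b \<in> ?G" "c \<in> ?G" for b c
    proof -
      from that obtain m n where mn: "m \<in> M" "n \<in> M" "inf m a \<le> b" "inf n a \<le> c" by blast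
      have "inf (inf m n) a = inf (inf m a) (inf n a)" by (simp add: inf_aci)
      also have "\<dots> \<le> inf b c" using mn(3,4) by (rule inf_mono)
      finally have "inf (inf m n) a \<le> inf b c" .
      moreover have "inf m n \<in> M" using proper_filter_inf[OF M(1)] mn by blast
      ultimately show ?thesis by blast
    qed
    ultimately have "proper_filter ?G"
      unfolding proper_filter_def using top by (auto intro: order_trans)
    moreover have "M \<subseteq> ?G" by (auto intro: le_infI1)
    ultimately have "?G = M" by (rule max)
    moreover have "a \<in> ?G" using top by auto
    ultimately show False using no by blast
  qed
  with M show ?thesis unfolding ultra_def by blast
qed

lemma ex_ultra_containing:
  fixes a :: "'a::boolean_algebra"
  assumes "a \<noteq> bot" shows "\<exists>U. ultra U \<and> a \<in> U"
proof -
  have "proper_filter {b. a \<le> b}"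
    using assms by (auto simp: proper_filter_def bot_unique intro: order_trans)
  from proper_filter_extends_ultra[OF this] show ?thesis by blast
qed

text \<open>An ultrafilter extending the cofinite sets, packed as a \<open>filter\<close> so that
  limits along it are instances of \<open>tendsto\<close>.\<close>

lemma ex_nonprincipal_ultrafilter_on_nat:
  "\<exists>F :: nat filter. F \<noteq> bot \<and> F \<le> sequentially \<and>
     (\<forall>P. eventually P F \<or> eventually (\<lambda>n. \<not> P n) F)"
proof -
  have "proper_filter {A :: nat set. finite (- A)}"
    by (auto simp: proper_filter_def Compl_Int intro: finite_subset)
  then obtain U where U: "ultra U" "{A :: nat set. finite (- A)} \<subseteq> U"
    using proper_filter_extends_ultra by blast
  define F where "F = Abs_filter (\<lambda>P. {n. P n} \<in> U)"
  have "is_filter (\<lambda>P. {n :: nat. P n} \<in> U)"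
  proof
    show "{n. True} \<in> U" using ultra_top[OF U(1)] by (simp add: top_set_def)
    show "{n. P n \<and> Q n} \<in> U" if "{n. P n} \<in> U" "{n. Q n} \<in> U" for P Q
      using that ultra_inf[OF U(1)] by (simp add: Collect_conj_eq)
    show "{n. Q n} \<in> U" if "\<forall>n. P n \<longrightarrow> Q n" "{n. P n} \<in> U" for P Q
      using that ultra_mono[OF U(1)] by (metis Collect_mono)
  qed
  then have ev: "eventually P F \<longleftrightarrow> {n. P n} \<in> U" for P
    unfolding F_def by (rule eventually_Abs_filter)
  have "F \<noteq> bot"
    using ev[of "\<lambda>_. False"] ultra_bot[OF U(1)] by (auto simp: trivial_limit_def)
  moreover have "F \<le> sequentially"
  proof (rule filter_leI)
    fix P assume "eventually P sequentially"
    then have "finite {n. \<not> P n}"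
      by (auto simp: eventually_sequentially not_le intro: finite_subset[of _ "{..<_}"])
        (metis (no_types, lifting) finite_nat_set_iff_bounded mem_Collect_eq not_le)
    then have "finite (- {n. P n})" by (simp add: Collect_neg_eq)
    then show "eventually P F" using U(2) ev by blast
  qed
  moreover have "eventually P F \<or> eventually (\<lambda>n. \<not> P n) F" for P
    using ultra_compl[OF U(1), of "{n. P n}"] unfolding ev by (auto simp: Collect_neg_eq)
  ultimately show ?thesis by blast
qed

text \<open>The limit is the supremum of the eventual lower bounds; a number above it is not one of
  them, so the ultrafilter makes it an eventual strict upper bound.\<close>

lemma bounded_tendsto_ultrafilter:
  fixes x :: "nat \<Rightarrow> real"
  assumes "F \<noteq> bot" "\<And>P. eventually P F \<or> eventually (\<lambda>n. \<not> P n) F" "\<And>n. \<bar>x n\<bar> \<le> B"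
  shows "\<exists>L. (x \<longlongrightarrow> L) F"
proof -
  define A where "A = {y. eventually (\<lambda>n. y \<le> x n) F}"
  have lower: "- B \<in> A" using assms(3) by (simp add: A_def abs_le_iff minus_le_iff)
  have upper: "y \<le> B" if "y \<in> A" for y
  proof (rule ccontr)
    assume "\<not> y \<le> B"
    then have "eventually (\<lambda>n. False) F"
      using that assms(3) unfolding A_def by (auto elim!: eventually_mono simp: abs_le_iff) (meson order_trans)
    then show False using assms(1) by (simp add: trivial_limit_def)
  qed
  have bdd: "bdd_above A" using upper by (rule bdd_aboveI)
  have "(x \<longlongrightarrow> Sup A) F"
  proof (rule order_tendstoI)
    fix l assume "l < Sup A"
    then obtain y where "y \<in> A" "l < y" using less_cSup_iff[OF _ bdd] lower by blast
    then show "eventually (\<lambda>n. l < x n) F" unfolding A_def by (auto elim: eventually_mono)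
  next
    fix u assume "Sup A < u"
    then have "u \<notin> A" using cSup_upper[OF _ bdd] by force
    then show "eventually (\<lambda>n. x n < u) F"
      using assms(2)[of "\<lambda>n. u \<le> x n"] by (simp add: A_def not_le)
  qed
  then show ?thesis by blast
qed

subsection \<open>A biorthogonal pointwise null sequence in the ground model\<close>

text \<open>The bound 2 fits both constructions below: twice a limit of measures of variation at
  most 1, and a difference of two point masses.\<close>

definition biorthogonal_null_sequence ::
    "(nat \<Rightarrow> 'a::boolean_algebra \<Rightarrow> real) \<Rightarrow> (nat \<Rightarrow> 'a) \<Rightarrow> bool"
  where "biorthogonal_null_sequence \<nu> d \<longleftrightarrow>
    (\<forall>n a b. inf a b = bot \<longrightarrow> \<nu> n (sup a b) = \<nu> n a + \<nu> n b) \<and>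
    (\<forall>n as. sorted_wrt (\<lambda>a b. inf a b = bot) as \<longrightarrow> (\<Sum>a\<leftarrow>as. \<bar>\<nu> n a\<bar>) \<le> 2) \<and>
    (\<forall>a. (\<lambda>n. \<nu> n a) \<longlonglongrightarrow> 0) \<and>
    (\<forall>m n. \<nu> m (d n) = of_bool (m = n))"

section \<open>Point masses: additivity and variation\<close>

lemma dirac_sup:
  "ultra U \<Longrightarrow> inf a b = bot \<Longrightarrow>
    (of_bool (sup a b \<in> U) :: real) = of_bool (a \<in> U) + of_bool (b \<in> U)"
  using ultra_disjoint[of U a b] by (auto simp: ultra_sup)

lemma dirac_sum_list_le_1:
  assumes "ultra U" "sorted_wrt (\<lambda>a b. inf a b = bot) as"
  shows "(\<Sum>a\<leftarrow>as. of_bool (a \<in> U) :: real) \<le> 1"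
  using assms(2)
proof (induction as)
  case (Cons a as)
  show ?case
  proof (cases "a \<in> U")
    case True
    then have "\<forall>b\<in>set as. b \<notin> U"
      using Cons.prems ultra_disjoint[OF assms(1), of a] by auto
    then have "(\<Sum>a\<leftarrow>as. of_bool (a \<in> U) :: real) = (\<Sum>a\<leftarrow>as. 0)"
      by (intro arg_cong[of _ _ sum_list] map_cong) auto
    then show ?thesis using True by simp
  qed (use Cons in simp)
qed simp

section \<open>The atomless case: a Cantor scheme and its Rademacher functions\<close>

lemma ex_join_of_finite_family:
  fixes e :: "'k \<Rightarrow> 'a::boolean_algebra"
  assumes "finite K"
  shows "\<exists>c. \<forall>U. ultra U \<longrightarrow> (c \<in> U \<longleftrightarrow> (\<exists>k\<in>K. e k \<in> U))"
  using assms
proof (induction K)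
  case empty
  then show ?case using ultra_bot by blast
next
  case (insert k K)
  then obtain c where "\<forall>U. ultra U \<longrightarrow> (c \<in> U \<longleftrightarrow> (\<exists>k\<in>K. e k \<in> U))" by blast
  then show ?case by (intro exI[of _ "sup c (e k)"]) (auto simp: ultra_sup)
qed

text \<open>Splitting r again and again inside P gives a binary tree of nonzero elements;
  \<open>c n\<close> joins the nodes that chose \<beta> at the n-th splitting, and
  \<open>x N S\<close> is an ultrafilter through a node of level N. So the \<open>x N S\<close> act
  as vertices of an N-dimensional cube with coordinates \<open>c n\<close>, n < N.\<close>

lemma ex_independent_sequence:
  fixes r :: "'a::boolean_algebra"
  assumes "P r" "\<not> P bot" and split: "\<And>c. P c \<Longrightarrow> \<exists>b. P (inf c b) \<and> P (inf c (- b))"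
  shows "\<exists>(c :: nat \<Rightarrow> 'a) x. \<forall>N S. ultra (x N S) \<and> (\<forall>n<N. c n \<in> x N S \<longleftrightarrow> n \<in> S)"
proof -
  from split obtain \<beta> where \<beta>: "\<And>c. P c \<Longrightarrow> P (inf c (\<beta> c)) \<and> P (inf c (- \<beta> c))"
    by metis
  \<comment> \<open>\<open>a N S\<close> is the node of level N on the branch S; only the part of S
    below N matters.\<close>
  define a where "a = (\<lambda>N (S :: nat set).
    rec_nat r (\<lambda>N v. inf v (if N \<in> S then \<beta> v else - \<beta> v)) N)"
  have a0: "a 0 S = r" and aS: "a (Suc N) S = inf (a N S) (if N \<in> S then \<beta> (a N S) else - \<beta> (a N S))"
    for N S by (simp_all add: a_def)
  have Pa: "P (a N S)" for N S
    by (induction N) (use assms(1) \<beta> in \<open>auto simp: a0 aS\<close>)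
  have local: "a N S = a N T" if "S \<inter> {..<N} = T \<inter> {..<N}" for N S T
    using that
  proof (induction N)
    case (Suc N)
    have "S \<inter> {..<N} = T \<inter> {..<N}" "N \<in> S \<longleftrightarrow> N \<in> T"
      using Suc.prems by (auto simp: lessThan_Suc)
    with Suc.IH show ?case by (simp add: aS)
  qed (simp add: a0)
  have anti: "a N S \<le> a n S" if "n \<le> N" for n N S
    using that by (induction rule: dec_induct) (auto simp: aS intro: le_infI1)
  \<comment> \<open>Different nodes of one level are disjoint, stated through ultrafilters.\<close>
  have sep: "S \<inter> {..<N} = T \<inter> {..<N}" if "ultra U" "a N S \<in> U" "a N T \<in> U" for U N S T
    using that(2,3)
  proof (induction N)
    case (Suc N)
    have *: "a N S \<in> U" "a N T \<in> U"
      "(if N \<in> S then \<beta> (a N S) else - \<beta> (a N S)) \<in> U"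
      "(if N \<in> T then \<beta> (a N T) else - \<beta> (a N T)) \<in> U"
      using Suc.prems by (simp_all only: aS ultra_inf[OF that(1)])
    have eq: "S \<inter> {..<N} = T \<inter> {..<N}" using Suc.IH * by blast
    then have "a N S = a N T" by (rule local)
    with * have "N \<in> S \<longleftrightarrow> N \<in> T" by (auto simp: ultra_compl[OF that(1)] split: if_splits)
    with eq show ?case by (auto simp: lessThan_Suc)
  qed simp
  have "\<exists>U. ultra U \<and> a N S \<in> U" for N S
    using Pa[of N S] assms(2) by (intro ex_ultra_containing) metis
  then obtain x where x: "\<And>N S. ultra (x N S)" "\<And>N S. a N S \<in> x N S" by metis
  \<comment> \<open>The choice at n first shows at level n + 1; T runs over the possible earlier
    choices.\<close>
  have "\<exists>c. \<forall>U. ultra U \<longrightarrow> (c \<in> U \<longleftrightarrow> (\<exists>T\<in>Pow {..<n}. a (Suc n) (insert n T) \<in> U))" for n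
    by (rule ex_join_of_finite_family) simp
  then obtain c where c: "\<And>n U. ultra U \<Longrightarrow>
      c n \<in> U \<longleftrightarrow> (\<exists>T\<in>Pow {..<n}. a (Suc n) (insert n T) \<in> U)" by metis
  have "c n \<in> x N S \<longleftrightarrow> n \<in> S" if "n < N" for n N S
  proof -
    have S: "a (Suc n) S \<in> x N S"
      using ultra_mono[OF x(1) x(2) anti[of "Suc n" N S]] that by simp
    show ?thesis
    proof
      assume "c n \<in> x N S"
      then obtain T where "a (Suc n) (insert n T) \<in> x N S" using c[OF x(1)] by blast
      from sep[OF x(1) S this] show "n \<in> S" by (auto simp: lessThan_Suc)
    next
      assume "n \<in> S"
      then have "a (Suc n) (insert n (S \<inter> {..<n})) = a (Suc n) S" by (intro local) (auto simp: lessThan_Suc)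
      with S show "c n \<in> x N S" using c[OF x(1)] by (metis Int_lower2 PowI)
    qed
  qed
  with x(1) show ?thesis by blast
qed

definition rademacher :: "nat \<Rightarrow> nat set \<Rightarrow> real"
  where "rademacher n S = (if n \<in> S then 1 else - 1)"

text \<open>Toggling n is an involution of the cube that flips the sign of
  \<open>rademacher n\<close> and preserves g, so the terms cancel in pairs.\<close>

lemma sum_rademacher_invariant:
  assumes "n < N" "\<And>S. g (insert n S) = g (S - {n})"
  shows "(\<Sum>S\<in>Pow {..<N}. rademacher n S * g S) = 0"
proof -
  define t where "t = (\<lambda>S. if n \<in> S then S - {n} else insert n S)"
  have g: "g (t S) = g S" for S
    using assms(2)[of S] by (auto simp: t_def insert_absorb)
  have "(\<Sum>S\<in>Pow {..<N}. rademacher n S * g S) = (\<Sum>S\<in>Pow {..<N}. - (rademacher n S * g S))"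
  proof (rule sum.reindex_bij_witness[of _ t t])
    fix S assume "S \<in> Pow {..<N}"
    then show "t S \<in> Pow {..<N}" "t (t S) = S" using assms(1) by (auto simp: t_def)
    show "- (rademacher n (t S) * g (t S)) = rademacher n S * g S"
      unfolding g by (auto simp: t_def rademacher_def)
  qed (use assms(1) in \<open>auto simp: t_def\<close>)
  then show ?thesis by (simp add: sum_negf)
qed

lemma sum_rademacher:
  "n < N \<Longrightarrow> (\<Sum>S\<in>Pow {..<N}. rademacher n S) = 0"
  using sum_rademacher_invariant[of n N "\<lambda>_. 1"] by simp

lemma rademacher_orthogonal:
  assumes "m < N" "n < N"
  shows "(\<Sum>S\<in>Pow {..<N}. rademacher m S * rademacher n S) = (if m = n then 2 ^ N else 0)"
proof (cases "m = n")
  case True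
  then have "(\<Sum>S\<in>Pow {..<N}. rademacher m S * rademacher n S) = (\<Sum>S\<in>Pow {..<N}. 1)"
    by (intro sum.cong) (auto simp: rademacher_def)
  with True show ?thesis by (simp add: card_Pow)
next
  case False
  with sum_rademacher_invariant[OF assms(1), of "rademacher n"] show ?thesis
    by (simp add: rademacher_def)
qed

text \<open>Expand the sum of squares of V minus its projection to the span of the r n. M is their
  common squared norm, and v n is the n-th Fourier coefficient of V.\<close>

lemma bessel_inequality:
  fixes r :: "nat \<Rightarrow> 's \<Rightarrow> real"
  assumes orth: "\<And>m n. m < K \<Longrightarrow> n < K \<Longrightarrow> (\<Sum>s\<in>X. r m s * r n s) = (if m = n then M else 0)"
    and v: "\<And>n. n < K \<Longrightarrow> (\<Sum>s\<in>X. r n s * V s) = M * v n"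
  shows "M * (\<Sum>n<K. (v n)\<^sup>2) \<le> (\<Sum>s\<in>X. (V s)\<^sup>2)"
proof -
  let ?p = "\<lambda>s. \<Sum>n<K. v n * r n s"
  have cross: "(\<Sum>s\<in>X. V s * ?p s) = M * (\<Sum>n<K. (v n)\<^sup>2)"
  proof -
    have "(\<Sum>s\<in>X. V s * ?p s) = (\<Sum>n<K. v n * (\<Sum>s\<in>X. r n s * V s))"
      unfolding sum_distrib_left by (subst sum.swap) (simp add: mult_ac)
    also have "\<dots> = (\<Sum>n<K. v n * (M * v n))" by (intro sum.cong) (auto simp: v)
    finally show ?thesis by (simp add: sum_distrib_left power2_eq_square mult_ac)
  qed
  have square: "(\<Sum>s\<in>X. (?p s)\<^sup>2) = M * (\<Sum>n<K. (v n)\<^sup>2)"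
  proof -
    have "(\<Sum>s\<in>X. (?p s)\<^sup>2) = (\<Sum>s\<in>X. \<Sum>m<K. \<Sum>n<K. v m * v n * (r m s * r n s))"
      unfolding power2_eq_square sum_product by (simp add: mult_ac)
    also have "\<dots> = (\<Sum>m<K. \<Sum>s\<in>X. \<Sum>n<K. v m * v n * (r m s * r n s))"
      by (rule sum.swap)
    also have "\<dots> = (\<Sum>m<K. \<Sum>n<K. v m * v n * (\<Sum>s\<in>X. r m s * r n s))"
      unfolding sum_distrib_left by (intro sum.cong refl sum.swap)
    also have "\<dots> = (\<Sum>m<K. \<Sum>n<K. if m = n then v m * v m * M else 0)"
      by (intro sum.cong refl) (auto simp: orth)
    also have "\<dots> = (\<Sum>m<K. v m * v m * M)" by (simp add: sum.delta)
    finally show ?thesis by (simp add: sum_distrib_left power2_eq_square mult_ac)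
  qed
  have "0 \<le> (\<Sum>s\<in>X. (V s - ?p s)\<^sup>2)" by (intro sum_nonneg) simp
  also have "\<dots> = (\<Sum>s\<in>X. (V s)\<^sup>2) - 2 * (\<Sum>s\<in>X. V s * ?p s) + (\<Sum>s\<in>X. (?p s)\<^sup>2)"
    by (simp add: power2_diff sum.distrib sum_subtractf sum_distrib_left mult_ac)
  finally show ?thesis using cross square by simp
qed

lemma tendsto_sum_list_map:
  fixes f :: "'i \<Rightarrow> 'b \<Rightarrow> real"
  assumes "\<And>a. a \<in> set as \<Longrightarrow> ((\<lambda>i. f i a) \<longlongrightarrow> L a) F"
  shows "((\<lambda>i. \<Sum>a\<leftarrow>as. f i a) \<longlongrightarrow> (\<Sum>a\<leftarrow>as. L a)) F"
  using assms by (induction as) (auto intro!: tendsto_add)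

lemma sum_list_sum_swap:
  fixes g :: "'b \<Rightarrow> 'c \<Rightarrow> real"
  shows "(\<Sum>a\<leftarrow>as. \<Sum>s\<in>X. g a s) = (\<Sum>s\<in>X. \<Sum>a\<leftarrow>as. g a s)"
  by (induction as) (auto simp: sum.distrib)

text \<open>On each finite cube the n-th Rademacher function is the density of a signed measure, and
  an ultrafilter limit in the dimension N is a measure on the whole algebra. By Bessel's inequality
  its values at a fixed element are square summable in n, hence tend to 0.\<close>

lemma biorthogonal_null_sequence_of_independent:
  fixes c :: "nat \<Rightarrow> 'a::boolean_algebra"
  assumes x: "\<And>N S. ultra (x N S)" and c: "\<And>n N S. n < N \<Longrightarrow> c n \<in> x N S \<longleftrightarrow> n \<in> S"
  shows "\<exists>\<nu>. biorthogonal_null_sequence \<nu> c"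
proof -
  obtain F :: "nat filter" where F: "F \<noteq> bot" "F \<le> sequentially"
      "\<And>P. eventually P F \<or> eventually (\<lambda>n. \<not> P n) F"
    using ex_nonprincipal_ultrafilter_on_nat by blast
  define \<eta> where "\<eta> = (\<lambda>N n b. (\<Sum>S\<in>Pow {..<N}. rademacher n S * of_bool (b \<in> x N S)) / 2 ^ N)"
  have variation: "(\<Sum>a\<leftarrow>as. \<bar>\<eta> N n a\<bar>) \<le> 1"
    if "sorted_wrt (\<lambda>a b. inf a b = bot) as" for N n as
  proof -
    have "\<bar>\<eta> N n a\<bar> \<le> (\<Sum>S\<in>Pow {..<N}. of_bool (a \<in> x N S)) / 2 ^ N" for a
    proof -
      have "\<bar>\<Sum>S\<in>Pow {..<N}. rademacher n S * of_bool (a \<in> x N S)\<bar> \<le>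
          (\<Sum>S\<in>Pow {..<N}. \<bar>rademacher n S * of_bool (a \<in> x N S)\<bar>)" by (rule sum_abs)
      also have "\<dots> = (\<Sum>S\<in>Pow {..<N}. of_bool (a \<in> x N S))"
        by (intro sum.cong refl) (simp add: rademacher_def)
      finally show ?thesis by (simp only: \<eta>_def abs_divide) (simp add: divide_right_mono)
    qed
    then have "(\<Sum>a\<leftarrow>as. \<bar>\<eta> N n a\<bar>) \<le> (\<Sum>a\<leftarrow>as. (\<Sum>S\<in>Pow {..<N}. of_bool (a \<in> x N S)) / 2 ^ N)"
      by (intro sum_list_mono)
    also have "\<dots> = (\<Sum>S\<in>Pow {..<N}. \<Sum>a\<leftarrow>as. of_bool (a \<in> x N S)) / 2 ^ N"
      by (simp only: divide_inverse sum_list_mult_const sum_list_sum_swap)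
    also have "\<dots> \<le> (\<Sum>S\<in>Pow {..<N}. 1) / 2 ^ N"
      by (intro divide_right_mono sum_mono dirac_sum_list_le_1 x that) simp
    also have "\<dots> = 1" by (simp add: card_Pow)
    finally show ?thesis .
  qed
  have bound: "\<bar>\<eta> N n b\<bar> \<le> 1" for N n b
    using variation[of "[b]"] by simp
  have "\<exists>L. ((\<lambda>N. \<eta> N n b) \<longlongrightarrow> L) F" for n b
    by (rule bounded_tendsto_ultrafilter[OF F(1,3) bound])
  then obtain \<zeta> where lim: "\<And>n b. ((\<lambda>N. \<eta> N n b) \<longlongrightarrow> \<zeta> n b) F" by metis
  have add: "\<zeta> n (sup a b) = \<zeta> n a + \<zeta> n b" if "inf a b = bot" for n a b
  proof (rule tendsto_unique[OF F(1) lim])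
    have "\<eta> N n (sup a b) = \<eta> N n a + \<eta> N n b" for N
      unfolding \<eta>_def dirac_sup[OF x that]
      by (simp add: sum.distrib distrib_left add_divide_distrib)
    then show "((\<lambda>N. \<eta> N n (sup a b)) \<longlongrightarrow> \<zeta> n a + \<zeta> n b) F"
      by (simp add: tendsto_add lim)
  qed
  have var: "(\<Sum>a\<leftarrow>as. \<bar>\<zeta> n a\<bar>) \<le> 1" if "sorted_wrt (\<lambda>a b. inf a b = bot) as" for n as
    by (rule tendsto_upperbound[OF tendsto_sum_list_map[OF tendsto_rabs[OF lim]] _ F(1)])
      (simp add: variation that)
  have dual: "\<zeta> m (c n) = of_bool (m = n) / 2" for m n
  proof (rule tendsto_unique[OF F(1) lim])
    have "\<eta> N m (c n) = of_bool (m = n) / 2" if N: "N \<ge> Suc (max m n)" for N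
    proof -
      \<comment> \<open>The indicator of \<open>c n\<close> on the cube is (1 +
        \<open>rademacher n\<close>) / 2; the constant is orthogonal to \<open>rademacher m\<close>,
        which leaves the factor 1/2.\<close>
      have "(\<Sum>S\<in>Pow {..<N}. rademacher m S * of_bool (c n \<in> x N S)) =
          (\<Sum>S\<in>Pow {..<N}. (rademacher m S + rademacher m S * rademacher n S) / 2)"
        using N by (intro sum.cong refl) (auto simp: c rademacher_def)
      also have "\<dots> = (if m = n then 2 ^ N else 0) / 2"
        using N by (simp only: sum_divide_distrib[symmetric] sum.distrib)
          (simp add: sum_rademacher rademacher_orthogonal)
      finally show ?thesis by (simp add: \<eta>_def)
    qed
    then have "eventually (\<lambda>N. \<eta> N m (c n) = of_bool (m = n) / 2) sequentially"
      using eventually_sequentially by blast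
    then have "eventually (\<lambda>N. \<eta> N m (c n) = of_bool (m = n) / 2) F"
      using F(2) filter_leD by blast
    then show "((\<lambda>N. \<eta> N m (c n)) \<longlongrightarrow> of_bool (m = n) / 2) F"
      by (rule tendsto_eventually)
  qed
  have bessel: "(\<Sum>n<K. (\<zeta> n b)\<^sup>2) \<le> 1" for K b
  proof (rule tendsto_upperbound[OF _ _ F(1)])
    show "((\<lambda>N. \<Sum>n<K. (\<eta> N n b)\<^sup>2) \<longlongrightarrow> (\<Sum>n<K. (\<zeta> n b)\<^sup>2)) F"
      by (intro tendsto_sum tendsto_power lim)
    have "(\<Sum>n<K. (\<eta> N n b)\<^sup>2) \<le> 1" if "N \<ge> K" for N
    proof -
      \<comment> \<open>\<open>\<eta> N n b\<close> is the n-th Fourier coefficient of the indicator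
        of b on the cube, whose first K \<le> N Rademacher functions are orthogonal.\<close>
      have "2 ^ N * (\<Sum>n<K. (\<eta> N n b)\<^sup>2) \<le> (\<Sum>S\<in>Pow {..<N}. (of_bool (b \<in> x N S) :: real)\<^sup>2)"
        by (rule bessel_inequality[where r = rademacher])
          (use that in \<open>auto simp: rademacher_orthogonal \<eta>_def\<close>)
      also have "\<dots> \<le> (\<Sum>S\<in>Pow {..<N}. 1)" by (intro sum_mono) simp
      also have "\<dots> = 2 ^ N" by (simp add: card_Pow)
      finally show ?thesis by simp
    qed
    then have "eventually (\<lambda>N. (\<Sum>n<K. (\<eta> N n b)\<^sup>2) \<le> 1) sequentially"
      using eventually_sequentially by blast
    then show "eventually (\<lambda>N. (\<Sum>n<K. (\<eta> N n b)\<^sup>2) \<le> 1) F"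
      using F(2) filter_leD by blast
  qed
  have null: "(\<lambda>n. \<zeta> n b) \<longlonglongrightarrow> 0" for b
  proof -
    have "summable (\<lambda>n. (\<zeta> n b)\<^sup>2)"
      by (rule summableI_nonneg_bounded[OF _ bessel]) simp
    then have "(\<lambda>n. (\<zeta> n b)\<^sup>2) \<longlonglongrightarrow> 0" by (rule summable_LIMSEQ_zero)
    then show ?thesis by (simp add: power_tendsto_0_iff)
  qed
  \<comment> \<open>Doubling turns the diagonal values 1/2 into 1.\<close>
  have "biorthogonal_null_sequence (\<lambda>n b. 2 * \<zeta> n b) c"
    unfolding biorthogonal_null_sequence_def
    using add var tendsto_mult_right_zero[OF null]
    by (auto simp: abs_mult sum_list_const_mult dual)
  then show ?thesis by blast
qed

section \<open>The case of an atom modulo the elements with finitely many elements below\<close>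

lemma finite_below_sup:
  fixes a b :: "'a::boolean_algebra"
  assumes "finite {y. y \<le> a}" "finite {y. y \<le> b}"
  shows "finite {y. y \<le> sup a b}"
proof (rule finite_subset)
  show "{y. y \<le> sup a b} \<subseteq> (\<lambda>(u, v). sup u v) ` ({y. y \<le> a} \<times> {y. y \<le> b})"
  proof
    fix y assume "y \<in> {y. y \<le> sup a b}"
    then have "y = sup (inf y a) (inf y b)" by (simp add: inf_sup_distrib1[symmetric] inf_absorb1)
    then show "y \<in> (\<lambda>(u, v). sup u v) ` ({y. y \<le> a} \<times> {y. y \<le> b})"
      by (intro image_eqI[of _ _ "(inf y a, inf y b)"]) auto
  qed
qed (use assms in simp)

text \<open>Together with closure under \<open>sup\<close>, this makes the elements with finitely
  many elements below an ideal.\<close>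

lemma finite_below_mono: "finite {y. y \<le> b} \<Longrightarrow> a \<le> b \<Longrightarrow> finite {y. y \<le> (a::'a::order)}"
  by (rule finite_subset) (auto intro: order_trans)

text \<open>The b that meet a outside the ideal form an ultrafilter X. Disjoint nonzero members
  \<open>t n\<close> of the ideal below a carry points \<open>y n\<close> that converge to X, so the
  differences of point masses are null; \<open>t n\<close> separates \<open>y n\<close> from X and
  from the other points.\<close>

lemma biorthogonal_null_sequence_of_indecomposable:
  fixes a :: "'a::boolean_algebra"
  assumes inf_a: "infinite {y. y \<le> a}"
    and indec: "\<And>b. finite {y. y \<le> inf a b} \<or> finite {y. y \<le> inf a (- b)}"
  shows "\<exists>\<nu> d. biorthogonal_null_sequence \<nu> (d :: nat \<Rightarrow> 'a)"
proof -
  have split_a: "sup (inf u b) (inf u (- b)) = u" for u b :: 'a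
    by (simp add: inf_sup_distrib1[symmetric])
  define X where "X = {b. infinite {y. y \<le> inf a b}}"
  have X_compl: "- b \<in> X \<longleftrightarrow> b \<notin> X" for b
    using indec[of b] finite_below_sup[of "inf a b" "inf a (- b)"] inf_a
    by (auto simp: X_def split_a)
  have X_mono: "c \<in> X" if "b \<in> X" "b \<le> c" for b c
    using that(1) finite_below_mono[of "inf a c" "inf a b"] inf_mono[OF order_refl that(2)]
    unfolding X_def by blast
  have X_bot: "bot \<notin> X" by (simp add: X_def bot_unique del: le_inf_iff)
  have X_inf: "inf b c \<in> X" if "b \<in> X" "c \<in> X" for b c
  proof (rule ccontr)
    assume "inf b c \<notin> X"
    then have "finite {y. y \<le> sup (inf a (- b)) (inf a (inf b c))}"
      using that X_compl[of b] by (intro finite_below_sup) (auto simp: X_def)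
    moreover have "inf a c \<le> sup (inf a (- b)) (inf a (inf b c))"
    proof -
      have "inf a c = sup (inf (inf a c) b) (inf (inf a c) (- b))" by (simp only: split_a)
      also have "\<dots> \<le> sup (inf a (- b)) (inf a (inf b c))"
      proof (rule le_supI)
        show "inf (inf a c) b \<le> sup (inf a (- b)) (inf a (inf b c))"
          by (rule le_supI2) (simp add: inf_aci)
        show "inf (inf a c) (- b) \<le> sup (inf a (- b)) (inf a (inf b c))"
          by (rule le_supI1) (simp add: le_infI1)
      qed
      finally show ?thesis .
    qed
    ultimately have "finite {y. y \<le> inf a c}" by (rule finite_below_mono)
    then show False using that by (simp add: X_def)
  qed
  have "ultra X"
    using X_bot X_inf X_mono X_compl[of bot] unfolding ultra_def proper_filter_def
    by (auto simp: X_compl)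
  \<comment> \<open>Take b strictly between \<open>bot\<close> and u: by indecomposability of a,
    either b or its complement in u lies in the ideal, and neither is \<open>bot\<close>.\<close>
  have ex: "\<exists>t. t \<le> u \<and> t \<noteq> bot \<and> finite {y. y \<le> t}" if u: "u \<le> a" "infinite {y. y \<le> u}" for u
  proof -
    have "\<not> {y. y \<le> u} \<subseteq> {bot, u}" using u(2) finite_subset by blast
    then obtain b where b: "b \<le> u" "b \<noteq> bot" "b \<noteq> u" by blast
    have "inf u (- b) \<noteq> bot" using b by (metis antisym inf_shunt double_compl)
    moreover have "finite {y. y \<le> b} \<or> finite {y. y \<le> inf u (- b)}"
      using indec[of b] finite_below_mono b(1) u(1)
      by (metis inf.absorb2 inf_mono order_refl order_trans)
    ultimately show ?thesis using b by (metis inf_le1)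
  qed
  then obtain \<tau> where \<tau>: "\<And>u. u \<le> a \<Longrightarrow> infinite {y. y \<le> u} \<Longrightarrow>
      \<tau> u \<le> u \<and> \<tau> u \<noteq> bot \<and> finite {y. y \<le> \<tau> u}" by metis
  \<comment> \<open>What remains of a after removing the pieces chosen so far; it stays outside the
    ideal because only members of the ideal are removed.\<close>
  define r where "r = (\<lambda>n. ((\<lambda>u. inf u (- \<tau> u)) ^^ n) a)"
  have r: "r n \<le> a \<and> infinite {y. y \<le> r n}" for n
  proof (induction n)
    case 0
    then show ?case using inf_a by (simp add: r_def)
  next
    case (Suc n)
    have eq: "r (Suc n) = inf (r n) (- \<tau> (r n))" by (simp add: r_def)
    have "infinite {y. y \<le> r (Suc n)}"
    proof
      assume "finite {y. y \<le> r (Suc n)}"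
      then have "finite {y. y \<le> sup (inf (r n) (\<tau> (r n))) (inf (r n) (- \<tau> (r n)))}"
        using \<tau> Suc finite_below_mono[of "\<tau> (r n)"] unfolding eq by (intro finite_below_sup) auto
      then show False using Suc by (simp only: split_a)
    qed
    then show ?case using Suc eq by (auto intro: le_infI1)
  qed
  define t where "t = (\<lambda>n. \<tau> (r n))"
  have t: "t n \<le> r n" "t n \<noteq> bot" "finite {y. y \<le> t n}" for n
    using \<tau> r by (auto simp: t_def)
  have r_anti: "r n \<le> r m" if "m \<le> n" for m n
    using that by (induction rule: dec_induct) (auto simp: r_def intro: le_infI1)
  have "inf (t m) (t n) = bot" if "m < n" for m n
  proof -
    have "t n \<le> r (Suc m)" using t(1) r_anti[of "Suc m" n] that by (meson Suc_leI order_trans)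
    then have "t n \<le> - t m" by (simp add: r_def t_def)
    then show ?thesis by (metis inf.commute inf_shunt)
  qed
  then have disj: "inf (t m) (t n) = bot" if "m \<noteq> n" for m n
    using that by (metis inf.commute nat_neq_iff)
  obtain y where y: "\<And>n. ultra (y n)" "\<And>n. t n \<in> y n"
    using ex_ultra_containing[OF t(2)] by metis
  \<comment> \<open>A member of the ideal meets only finitely many of the disjoint
    \<open>t n\<close>, since the nonzero meets are different elements below it.\<close>
  have fin: "finite {n. inf (t n) e \<noteq> bot}" if "finite {y. y \<le> e}" for e
  proof (rule finite_imageD)
    show "finite ((\<lambda>n. inf (t n) e) ` {n. inf (t n) e \<noteq> bot})"
      by (rule finite_subset[OF _ that]) auto
    show "inj_on (\<lambda>n. inf (t n) e) {n. inf (t n) e \<noteq> bot}"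
    proof (rule inj_onI, rule ccontr)
      fix m n assume mn: "m \<in> {n. inf (t n) e \<noteq> bot}" "inf (t m) e = inf (t n) e" "m \<noteq> n"
      then have "inf (t m) e \<le> inf (t m) (t n)" by (metis inf.bounded_iff inf_le1)
      with disj[OF mn(3)] mn(1) show False by (simp add: bot_unique)
    qed
  qed
  have t_le_a: "t n \<le> a" for n using t(1) r order_trans by blast
  have t_notin: "t n \<notin> X" for n
    using t(3) t_le_a by (simp add: X_def inf_absorb2)
  have null: "(\<lambda>n. of_bool (b \<in> y n) - of_bool (b \<in> X) :: real) \<longlonglongrightarrow> 0" for b
  proof -
    \<comment> \<open>The part of a on which b disagrees with X: it lies in the ideal, and
      \<open>y n\<close> can disagree with X about b only if \<open>t n\<close> meets it.\<close>
    define e where "e = inf a (if b \<in> X then - b else b)"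
    have "finite {y. y \<le> e}"
      using X_compl[of b] by (auto simp: e_def X_def)
    have "b \<in> y n \<longleftrightarrow> b \<in> X" if "inf (t n) e = bot" for n
    proof -
      have "e \<notin> y n" using ultra_disjoint[OF y(1) that y(2)] .
      moreover have "a \<in> y n" using ultra_mono[OF y(1,2) t_le_a] .
      ultimately show ?thesis by (auto simp: e_def ultra_inf[OF y(1)] ultra_compl[OF y(1)] split: if_splits)
    qed
    then have "{n. \<not> (b \<in> y n \<longleftrightarrow> b \<in> X)} \<subseteq> {n. inf (t n) e \<noteq> bot}" by blast
    then have "finite {n. \<not> (b \<in> y n \<longleftrightarrow> b \<in> X)}"
      using fin[OF \<open>finite {y. y \<le> e}\<close>] finite_subset by blast
    then have "eventually (\<lambda>n. b \<in> y n \<longleftrightarrow> b \<in> X) sequentially"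
      unfolding cofinite_eq_sequentially[symmetric] eventually_cofinite .
    then have "eventually (\<lambda>n. of_bool (b \<in> y n) - of_bool (b \<in> X) = (0::real)) sequentially"
      by eventually_elim simp
    then show ?thesis by (rule tendsto_eventually)
  qed
  have "biorthogonal_null_sequence (\<lambda>n b. of_bool (b \<in> y n) - of_bool (b \<in> X)) t"
    unfolding biorthogonal_null_sequence_def
  proof (intro conjI allI impI)
    fix n and b c :: 'a assume "inf b c = bot"
    then show "of_bool (sup b c \<in> y n) - of_bool (sup b c \<in> X) =
        of_bool (b \<in> y n) - of_bool (b \<in> X) + (of_bool (c \<in> y n) - of_bool (c \<in> X) :: real)"
      by (simp only: dirac_sup[OF y(1)] dirac_sup[OF \<open>ultra X\<close>])
  next
    fix n and bs :: "'a list" assume bs: "sorted_wrt (\<lambda>a b. inf a b = bot) bs"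
    have "(\<Sum>b\<leftarrow>bs. \<bar>of_bool (b \<in> y n) - of_bool (b \<in> X) :: real\<bar>)
        \<le> (\<Sum>b\<leftarrow>bs. of_bool (b \<in> y n) + of_bool (b \<in> X))"
      by (intro sum_list_mono) auto
    also have "\<dots> \<le> 2"
      using dirac_sum_list_le_1[OF y(1) bs, of n] dirac_sum_list_le_1[OF \<open>ultra X\<close> bs]
      by (simp add: sum_list_addf)
    finally show "(\<Sum>b\<leftarrow>bs. \<bar>of_bool (b \<in> y n) - of_bool (b \<in> X) :: real\<bar>) \<le> 2" .
  next
    fix m n
    have "t n \<in> y m \<longleftrightarrow> m = n" using y disj[of m n] ultra_disjoint by blast
    then show "of_bool (t n \<in> y m) - of_bool (t n \<in> X) = (of_bool (m = n) :: real)"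
      using t_notin by simp
  qed (rule null)
  then show ?thesis by blast
qed

text \<open>
  This is the Josefson--Nissenzweig theorem for the Stone space of an infinite algebra. Modulo the
  ideal of elements with finitely many elements below, either there is an atom, which yields a
  convergent sequence of points, or the quotient is atomless and one transports the Rademacher
  functions along a Cantor scheme.
\<close>

lemma ex_biorthogonal_null_sequence:
  assumes "infinite (UNIV :: 'a::boolean_algebra set)"
  shows "\<exists>\<nu> d. biorthogonal_null_sequence \<nu> (d :: nat \<Rightarrow> 'a)"
proof (cases "\<forall>c :: 'a. infinite {y. y \<le> c} \<longrightarrow>
    (\<exists>b. infinite {y. y \<le> inf c b} \<and> infinite {y. y \<le> inf c (- b)})")
  case True
  have "\<exists>(c :: nat \<Rightarrow> 'a) x. \<forall>N S. ultra (x N S) \<and> (\<forall>n<N. c n \<in> x N S \<longleftrightarrow> n \<in> S)"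
    by (rule ex_independent_sequence[of "\<lambda>c. infinite {y. y \<le> c}" top]) (use assms True in \<open>auto simp: bot_unique simp del: le_inf_iff\<close>)
  then obtain c :: "nat \<Rightarrow> 'a" and x where
      cx: "\<forall>N S. ultra (x N S) \<and> (\<forall>n<N. c n \<in> x N S \<longleftrightarrow> n \<in> S)"
    by (elim exE)
  have "\<exists>\<nu>. biorthogonal_null_sequence \<nu> c"
    by (rule biorthogonal_null_sequence_of_independent[of x]) (use cx in auto)
  then show ?thesis by auto
next
  case False
  then obtain a :: 'a where a: "infinite {y. y \<le> a}"
      "\<And>b. finite {y. y \<le> inf a b} \<or> finite {y. y \<le> inf a (- b)}"
    by auto
  show ?thesis by (rule biorthogonal_null_sequence_of_indecomposable[OF a])
qed

subsection \<open>Ultrafilters and clopen sets in the extension\<close>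

lemmas mem_stronger = regularD_mono[OF regular_mem]

lemmas ultrafilter_stronger = regularD_mono[OF regular_ultrafilter]

lemma ultrafilter_iff:
  "ultrafilter U p \<longleftrightarrow> mem geq top U p \<and> (\<forall>q\<le>p. \<not> mem geq bot U q) \<and>
     (\<forall>a b. \<forall>q\<le>p. mem geq a U q \<and> mem geq b U q \<longrightarrow> mem geq (inf a b) U q) \<and>
     (\<forall>a b. \<forall>q\<le>p. mem geq a U q \<and> a \<le> b \<longrightarrow> mem geq b U q) \<and>
     (\<forall>a. \<forall>q\<le>p. \<exists>r\<le>q. mem geq a U r \<or> mem geq (- a) U r)"
  unfolding ultrafilter_def
  by (simp add: fImp_regular_iff regular_intros fNot_iff fOr_iff)

lemma ultrafilter_mono: "ultrafilter U p \<Longrightarrow> mem geq a U p \<Longrightarrow> a \<le> b \<Longrightarrow> mem geq b U p"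
  unfolding ultrafilter_iff by (meson order_refl)

lemma ultrafilter_inf:
  "ultrafilter U p \<Longrightarrow> mem geq a U p \<Longrightarrow> mem geq b U p \<Longrightarrow> mem geq (inf a b) U p"
  unfolding ultrafilter_iff by (meson order_refl)

lemma ultrafilter_disjoint:
  "ultrafilter U p \<Longrightarrow> mem geq a U p \<Longrightarrow> inf a b = bot \<Longrightarrow> \<not> mem geq b U p"
  using ultrafilter_inf[of U p a b] unfolding ultrafilter_iff by (metis order_refl)

lemma ultrafilter_decide:
  "ultrafilter U p \<Longrightarrow> \<exists>r\<le>p. mem geq a U r \<or> mem geq (- a) U r"
  unfolding ultrafilter_iff by (meson order_refl)

text \<open>Needed to apply \<open>mem_Collect\<close> to sets of points, whose forced equality is
  \<open>seteq geq\<close>.\<close>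

lemma ultrafilter_cong:
  assumes "seteq geq U W p" "ultrafilter W p"
  shows "ultrafilter U p"
proof -
  have eq: "mem geq a U q \<longleftrightarrow> mem geq a W q" if "q \<le> p" for a q
    using assms(1) that unfolding seteq_iff by blast
  note W = assms(2)[unfolded ultrafilter_iff]
  show ?thesis
    unfolding ultrafilter_iff
  proof (intro conjI allI impI)
    show "mem geq top U p" using W eq by (meson order_refl)
  next
    fix q assume "q \<le> p" then show "\<not> mem geq bot U q" using W eq by blast
  next
    fix a b q assume "q \<le> p" "mem geq a U q \<and> mem geq b U q"
    then show "mem geq (inf a b) U q" using W unfolding eq[OF \<open>q \<le> p\<close>] by blast
  next
    fix a b q assume "q \<le> p" "mem geq a U q \<and> a \<le> b"
    then show "mem geq b U q" using W unfolding eq[OF \<open>q \<le> p\<close>] by blast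
  next
    fix a q assume "q \<le> p"
    then obtain r where r: "r \<le> q" "mem geq a W r \<or> mem geq (- a) W r" using W by blast
    then have "r \<le> p" using \<open>q \<le> p\<close> order_trans by blast
    then show "\<exists>r\<le>q. mem geq a U r \<or> mem geq (- a) U r" using r eq by blast
  qed
qed

text \<open>Ranges over all names of points, so that ultrafilters new in the extension are
  included.\<close>

definition clopen :: "'a::boolean_algebra \<Rightarrow> ('a, 'p::preorder) pointset"
  where "clopen a = {(U, s). ultrafilter U s \<and> mem geq a U s}"

lemma pmem_clopen:
  fixes U :: "('a::boolean_algebra, 'p::preorder) point"
  shows "pmem U (clopen a) p \<longleftrightarrow> ultrafilter U p \<and> mem geq a U p"
  unfolding pmem_def clopen_def
proof (rule mem_Collect[where \<Psi> = "\<lambda>U s. ultrafilter U s \<and> mem geq a U s"])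
  show "regular (\<lambda>s. ultrafilter U s \<and> mem geq a U s)"
    using regular_fAnd[OF regular_ultrafilter[of U] regular_mem[of geq a U]] by (simp add: fAnd_def)
next
  fix W :: "('a, 'p) point" and q r
  assume *: "ultrafilter W q \<and> mem geq a W q" "r \<le> q"
  show "ultrafilter W r \<and> mem geq a W r"
    using *(1) ultrafilter_stronger[OF _ *(2), of W] mem_stronger[OF _ *(2), of geq a W] by simp
next
  fix W :: "('a, 'p) point" and r
  assume *: "seteq geq U W r" "ultrafilter W r \<and> mem geq a W r"
  then have "mem geq a U r" unfolding seteq_iff by (meson order_refl)
  then show "ultrafilter U r \<and> mem geq a U r" using * ultrafilter_cong[of U W r] by blast
qed (rule seteq_refl)

lemma stone_open_clopen: "stone_open (clopen a) p"
  unfolding stone_open_def in_stone_def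
  by (auto intro!: fImpI fExI[where x = a] simp: pmem_clopen intro: mem_stronger)

lemma stone_borel_clopen: "stone_borel (clopen a :: ('a::boolean_algebra, 'p::preorder) pointset) p"
  unfolding stone_borel_def
proof (rule fAllI)
  fix \<S> :: "(('a, 'p) pointset, 'p) name"
  show "(stone_sigma_algebra \<S> \<^bold>\<and> (\<^bold>\<forall>C. stone_open C \<^bold>\<longrightarrow> smem C \<S>) \<^bold>\<longrightarrow> smem (clopen a) \<S>) p"
  proof (rule fImpI_dense)
    fix q assume "q \<le> p" "(stone_sigma_algebra \<S> \<^bold>\<and> (\<^bold>\<forall>C. stone_open C \<^bold>\<longrightarrow> smem C \<S>)) q"
    then have "(stone_open (clopen a) \<^bold>\<longrightarrow> smem (clopen a) \<S>) q" by simp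
    then show "\<exists>r\<le>q. smem (clopen a) \<S> r" by (rule fImpE) (auto simp: stone_open_clopen)
  qed
qed

subsection \<open>Simple functions given by finite lists of clopen sets\<close>

text \<open>
  Both functions describe the simple function with value w on the first set of the list, plus w/2
  on the second one, and so on: the first one as a list of clopen pieces with their values, the
  second one by its value at a point containing the clopen sets that satisfy M.
\<close>

fun pieces :: "'a::boolean_algebra list \<Rightarrow> rat \<Rightarrow> ('a \<times> rat) list" where
  "pieces [] w = [(top, 0)]"
| "pieces (d # ds) w =
    map (\<lambda>(a, c). (inf d a, w + c)) (pieces ds (w / 2)) @
    map (\<lambda>(a, c). (inf (- d) a, c)) (pieces ds (w / 2))"

fun weight :: "('a \<Rightarrow> bool) \<Rightarrow> 'a list \<Rightarrow> rat \<Rightarrow> rat" where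
  "weight M [] w = 0"
| "weight M (d # ds) w = (if M d then w else 0) + weight M ds (w / 2)"

text \<open>2 / \<open>2 ^ J\<close> bounds the tail of the weights after J terms; J \<ge> N lets a
  prescribed value of f be among the decided ones.\<close>

lemma ex_pow_half_less:
  fixes \<epsilon> :: rat
  assumes "0 < \<epsilon>" shows "\<exists>J\<ge>N. 2 / 2 ^ J < \<epsilon>"
proof -
  obtain n where n: "(1 / 2 :: real) ^ n < of_rat \<epsilon> / 2"
    using real_arch_pow_inv[of "of_rat \<epsilon> / 2" "1 / 2 :: real"] assms by auto
  have "(1 / 2 :: real) ^ max N n \<le> (1 / 2) ^ n" by (intro power_decreasing) auto
  with n have "(of_rat (2 / 2 ^ max N n) :: real) < of_rat \<epsilon>"
    by (simp add: of_rat_divide of_rat_power power_divide)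
  then have "2 / 2 ^ max N n < \<epsilon>" by (simp only: of_rat_less)
  then show ?thesis by (intro exI[of _ "max N n"]) simp
qed

lemma weight_bounds: "0 \<le> w \<Longrightarrow> 0 \<le> weight M ds w \<and> weight M ds w \<le> 2 * w"
proof (induction ds arbitrary: w)
  case (Cons d ds)
  from Cons.IH[of "w / 2"] Cons.prems show ?case by auto
qed simp

lemma weight_mono: "0 \<le> w \<Longrightarrow> (\<And>d. M d \<Longrightarrow> M' d) \<Longrightarrow> weight M ds w \<le> weight M' ds w"
proof (induction ds arbitrary: w)
  case (Cons d ds)
  from Cons.IH[of "w / 2"] Cons.prems show ?case by (auto intro: add_mono)
qed simp

text \<open>M will be forced membership in a point, where some elements may still be undecided;
  being upward closed, it already contains every set that c counts.\<close>

lemma pieces_lower: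
  assumes "(a, c) \<in> set (pieces ds w)" "0 \<le> w" "M a" "\<And>a b. M a \<Longrightarrow> a \<le> b \<Longrightarrow> M b"
  shows "c \<le> weight M ds w"
  using assms(1-3)
proof (induction ds arbitrary: a c w)
  case (Cons d ds)
  from Cons.prems(1) consider
      (pos) a' c' where "(a', c') \<in> set (pieces ds (w / 2))" "a = inf d a'" "c = w + c'"
    | (neg) a' where "(a', c) \<in> set (pieces ds (w / 2))" "a = inf (- d) a'"
    by auto
  then show ?case
  proof cases
    case pos
    then have "M d" "M a'" using assms(4)[OF Cons.prems(3)] by simp_all
    then show ?thesis using Cons.IH[OF pos(1)] Cons.prems(2) pos(3) by simp
  next
    case neg
    then have "M a'" using assms(4)[OF Cons.prems(3)] by simp
    then show ?thesis using Cons.IH[OF neg(1)] Cons.prems(2) by simp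
  qed
qed simp

lemma pieces_nonneg: "(a, c) \<in> set (pieces ds w) \<Longrightarrow> 0 \<le> w \<Longrightarrow> 0 \<le> c"
proof (induction ds arbitrary: a c w)
  case (Cons d ds)
  from Cons.prems Cons.IH[of _ _ "w / 2"] show ?case by fastforce
qed simp

text \<open>On the common terms M contains the complement of every set that c does not count, so
  only the terms of ds' past the length of ds are left, a geometric tail. The list ds' may also be
  the shorter one.\<close>

lemma pieces_upper:
  assumes "(a, c) \<in> set (pieces ds w)" "0 \<le> w" "M a"
    "\<forall>j. j < length ds \<and> j < length ds' \<longrightarrow> ds ! j = ds' ! j"
    and M: "\<And>a b. M a \<Longrightarrow> a \<le> b \<Longrightarrow> M b" "\<And>b. M (- b) \<Longrightarrow> \<not> M b"
  shows "weight M ds' w \<le> c + 2 * w / 2 ^ length ds"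
  using assms(1-4)
proof (induction ds arbitrary: a c w ds')
  case Nil
  then show ?case using weight_bounds[of w M ds'] by simp
next
  case (Cons d ds)
  show ?case
  proof (cases ds')
    case Nil
    then show ?thesis using pieces_nonneg[OF Cons.prems(1,2)] Cons.prems(2) by simp
  next
    case (Cons d' ds'')
    have "\<forall>j. j < length ds \<and> j < length ds'' \<longrightarrow> ds ! j = ds'' ! j"
      using Cons.prems(4) unfolding Cons by (metis Suc_less_eq length_Cons nth_Cons_Suc)
    moreover have "d' = d" using Cons.prems(4) unfolding Cons by force
    ultimately have IH: "weight M ds'' (w / 2) \<le> c' + 2 * w / 2 ^ length (d # ds)"
      if "(a', c') \<in> set (pieces ds (w / 2))" "M a'" for a' c'
      using Cons.IH[OF that(1) _ that(2), of ds''] Cons.prems(2) by simp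
    from Cons.prems(1) consider
        (pos) a' c' where "(a', c') \<in> set (pieces ds (w / 2))" "a = inf d a'" "c = w + c'"
      | (neg) a' where "(a', c) \<in> set (pieces ds (w / 2))" "a = inf (- d) a'"
      by auto
    then show ?thesis
    proof cases
      case pos
      then have "M a'" using M(1)[OF Cons.prems(3)] by simp
      from IH[OF pos(1) this] show ?thesis using pos(3) Cons.prems(2) \<open>ds' = d' # ds''\<close> by simp
    next
      case neg
      then have "M a'" "M (- d)" using M(1)[OF Cons.prems(3)] by simp_all
      then show ?thesis using IH[OF neg(1)] M(2)[of d] \<open>ds' = d' # ds''\<close> \<open>d' = d\<close> by simp
    qed
  qed
qed

lemma pieces_cover:
  "ultrafilter U p \<Longrightarrow> \<exists>r\<le>p. \<exists>x\<in>set (pieces ds w). mem geq (fst x) U r"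
proof (induction ds arbitrary: w)
  case Nil
  then have "mem geq top U p" unfolding ultrafilter_iff by blast
  then show ?case by (intro exI[of _ p]) simp
next
  case (Cons d ds)
  from Cons.IH[OF Cons.prems, of "w / 2"] obtain r a c where r: "r \<le> p"
      "(a, c) \<in> set (pieces ds (w / 2))" "mem geq a U r" by auto
  have "ultrafilter U r" using Cons.prems r(1) by (rule ultrafilter_stronger)
  from ultrafilter_decide[OF this, of d] obtain s where s: "s \<le> r" "mem geq d U s \<or> mem geq (- d) U s"
    by blast
  have "ultrafilter U s" "mem geq a U s"
    using ultrafilter_stronger[OF \<open>ultrafilter U r\<close> s(1)] mem_stronger[OF r(3) s(1)] by simp_all
  then have "mem geq (inf d a) U s \<or> mem geq (inf (- d) a) U s"
    using s(2) ultrafilter_inf by blast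
  moreover have "s \<le> p" using s(1) r(1) order_trans by blast
  moreover have "(inf d a, w + c) \<in> set (pieces (d # ds) w)" "(inf (- d) a, c) \<in> set (pieces (d # ds) w)"
    using r(2) by force+
  ultimately show ?case by (metis fst_conv)
qed

lemma inf_inf_compl_eq_bot: "inf (inf d a) (inf (- d) b) = (bot :: 'a::boolean_algebra)"
proof -
  have "inf (inf d a) (inf (- d) b) = inf (inf d (- d)) (inf a b)" by (simp only: inf_aci)
  then show ?thesis by simp
qed

lemma pieces_disjoint: "sorted_wrt (\<lambda>a b. inf a b = bot) (map fst (pieces ds w))"
proof (induction ds arbitrary: w)
  case (Cons d ds)
  have sub: "sorted_wrt (\<lambda>a b. inf a b = bot) (map (\<lambda>x. inf e (fst x)) (pieces ds (w / 2)))" for e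
    using Cons.IH[of "w / 2"] unfolding sorted_wrt_map
    by (rule sorted_wrt_mono_rel[rotated]) (simp add: inf_left_commute inf.assoc)
  then show ?case using sub[of d] sub[of "- d"]
    by (auto simp: sorted_wrt_append case_prod_beta comp_def inf_inf_compl_eq_bot)
qed simp

text \<open>The pieces partition every e, not only \<open>top\<close>; the weighted sum below needs
  this for the part of e inside the first set of the list.\<close>

lemma pieces_sum_inf:
  fixes \<mu> :: "'a::boolean_algebra \<Rightarrow> real"
  assumes add: "\<And>a b. inf a b = bot \<Longrightarrow> \<mu> (sup a b) = \<mu> a + \<mu> b"
  shows "(\<Sum>x\<leftarrow>pieces ds w. \<mu> (inf (fst x) e)) = \<mu> e"
proof (induction ds arbitrary: w)
  case (Cons d ds)
  have "\<mu> (inf (inf d a) e) + \<mu> (inf (inf (- d) a) e) = \<mu> (inf a e)" for a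
  proof -
    have "sup (inf (inf d a) e) (inf (inf (- d) a) e) = inf a e"
      by (simp add: inf.assoc inf_sup_distrib2[symmetric])
    moreover have "inf (inf (inf d a) e) (inf (inf (- d) a) e) = bot"
      unfolding inf.assoc[of _ _ e] by (rule inf_inf_compl_eq_bot)
    ultimately show ?thesis using add by metis
  qed
  then show ?case using Cons.IH[of "w / 2"]
    by (simp add: case_prod_beta comp_def sum_list_addf[symmetric])
qed simp

text \<open>The integral of one simple function over e, computed piece by piece and term by term:
  the weight of a set, summed over the pieces inside it, gives its measure.\<close>

lemma pieces_weighted_sum_inf:
  fixes \<mu> :: "'a::boolean_algebra \<Rightarrow> real"
  assumes add: "\<And>a b. inf a b = bot \<Longrightarrow> \<mu> (sup a b) = \<mu> a + \<mu> b"
  shows "(\<Sum>x\<leftarrow>pieces ds w. of_rat (snd x) * \<mu> (inf (fst x) e)) =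
    (\<Sum>j<length ds. of_rat w / 2 ^ j * \<mu> (inf (ds ! j) e))"
proof (induction ds arbitrary: w)
  case (Cons d ds)
  let ?P = "pieces ds (w / 2)"
  have split: "\<mu> (inf (inf d a) e) + \<mu> (inf (inf (- d) a) e) = \<mu> (inf a e)" for a
    using pieces_sum_inf[where \<mu> = \<mu> and ds = "[d]" and e = "inf a e", OF add] by (simp add: inf.assoc)
  have "(\<Sum>x\<leftarrow>pieces (d # ds) w. of_rat (snd x) * \<mu> (inf (fst x) e)) =
      (\<Sum>x\<leftarrow>?P. of_rat (w + snd x) * \<mu> (inf (inf d (fst x)) e) +
        of_rat (snd x) * \<mu> (inf (inf (- d) (fst x)) e))"
    by (simp add: case_prod_beta comp_def sum_list_addf)
  also have "\<dots> = (\<Sum>x\<leftarrow>?P. of_rat w * \<mu> (inf (fst x) (inf d e)) + of_rat (snd x) * \<mu> (inf (fst x) e))"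
  proof (intro arg_cong[of _ _ sum_list] map_cong refl)
    fix x assume "x \<in> set ?P"
    have "inf (fst x) (inf d e) = inf (inf d (fst x)) e" by (simp add: inf_aci)
    then show "of_rat (w + snd x) * \<mu> (inf (inf d (fst x)) e) +
        of_rat (snd x) * \<mu> (inf (inf (- d) (fst x)) e) =
        of_rat w * \<mu> (inf (fst x) (inf d e)) + of_rat (snd x) * \<mu> (inf (fst x) e)"
      unfolding split[of "fst x", symmetric] by (simp add: of_rat_add distrib_left distrib_right)
  qed
  also have "\<dots> = of_rat w * \<mu> (inf d e) + (\<Sum>j<length ds. of_rat (w / 2) / 2 ^ j * \<mu> (inf (ds ! j) e))"
    by (simp add: sum_list_addf sum_list_const_mult pieces_sum_inf[OF add] Cons.IH)
  also have "\<dots> = (\<Sum>j<length (d # ds). of_rat w / 2 ^ j * \<mu> (inf ((d # ds) ! j) e))"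
    by (simp add: sum.lessThan_Suc_shift of_rat_divide del: sum.lessThan_Suc)
  finally show ?case .
qed simp

lemma pieces_weighted_sum:
  fixes \<mu> :: "'a::boolean_algebra \<Rightarrow> real"
  assumes "\<And>a b. inf a b = bot \<Longrightarrow> \<mu> (sup a b) = \<mu> a + \<mu> b"
  shows "(\<Sum>x\<leftarrow>pieces ds w. of_rat (snd x) * \<mu> (fst x)) = (\<Sum>j<length ds. of_rat w / 2 ^ j * \<mu> (ds ! j))"
  using pieces_weighted_sum_inf[where \<mu> = \<mu> and e = top, OF assms] by simp

subsection \<open>The measures and the continuous function in the extension\<close>

locale dominating_name =
  fixes f :: "(nat \<times> nat, 'p::preorder) name" and p\<^sub>0 :: 'p
    and \<nu> :: "nat \<Rightarrow> 'a::boolean_algebra \<Rightarrow> real" and d :: "nat \<Rightarrow> 'a"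
  assumes baire: "baire_real f p\<^sub>0" and dominating: "dominating_over_V f p\<^sub>0"
    and biorthogonal: "biorthogonal_null_sequence \<nu> d"
begin

section \<open>Deciding values of the dominating real\<close>

lemma value_exists: "q \<le> p\<^sub>0 \<Longrightarrow> \<exists>r\<le>q. \<exists>n. mem geq (k, n) f r"
  using baire unfolding baire_real_def by (auto simp: fEx_iff)

lemma value_unique:
  assumes "r \<le> p\<^sub>0" "mem geq (k, m) f r" "mem geq (k, n) f r"
  shows "m = n"
proof -
  have "(mem geq (k, m) f \<^bold>\<and> mem geq (k, n) f \<^bold>\<longrightarrow> ground (m = n)) p\<^sub>0"
    using baire unfolding baire_real_def by simp
  from fImpD[OF this _ regular_ground assms(1)] assms(2,3) show ?thesis
    by (simp add: regular_fAnd regular_mem)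
qed

lemma eventually_dominates:
  assumes "q \<le> p\<^sub>0"
  shows "\<exists>r\<le>q. \<exists>N. \<forall>n\<ge>N. \<forall>k. \<forall>s\<le>r. mem geq (n, k) f s \<longrightarrow> g n \<le> k"
proof -
  have "(\<^bold>\<exists>N. \<^bold>\<forall>n k. ground (N \<le> n) \<^bold>\<and> mem geq (n, k) f \<^bold>\<longrightarrow> ground (g n \<le> k)) p\<^sub>0"
    using dominating unfolding dominating_over_V_def by simp
  then obtain r N where r: "r \<le> q"
      "(\<^bold>\<forall>n k. ground (N \<le> n) \<^bold>\<and> mem geq (n, k) f \<^bold>\<longrightarrow> ground (g n \<le> k)) r"
    using assms unfolding fEx_iff[where p = p\<^sub>0] by blast
  have "g n \<le> k" if "N \<le> n" "s \<le> r" "mem geq (n, k) f s" for n k s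
  proof -
    have "(ground (N \<le> n) \<^bold>\<and> mem geq (n, k) f \<^bold>\<longrightarrow> ground (g n \<le> k)) r" using r(2) by simp
    from fImpD[OF this _ regular_ground that(2)] that(1,3) show ?thesis
      by (simp add: regular_fAnd regular_mem regular_ground)
  qed
  with r(1) show ?thesis by blast
qed

definition decides :: "nat list \<Rightarrow> 'p \<Rightarrow> bool"
  where "decides ks r \<longleftrightarrow> (\<forall>j<length ks. mem geq (j, ks ! j) f r)"

lemma decides_mono: "decides ks r \<Longrightarrow> s \<le> r \<Longrightarrow> decides ks s"
  unfolding decides_def by (auto intro: mem_stronger)

lemma decides_exists:
  assumes "q \<le> p\<^sub>0"
  shows "\<exists>r\<le>q. \<exists>ks. length ks = J \<and> decides ks r"
proof (induction J)
  case 0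
  then show ?case by (auto simp: decides_def)
next
  case (Suc J)
  then obtain r ks where r: "r \<le> q" "length ks = J" "decides ks r" by blast
  then have "r \<le> p\<^sub>0" using assms order_trans by blast
  then obtain s n where s: "s \<le> r" "mem geq (J, n) f s" using value_exists by blast
  have "decides (ks @ [n]) s"
    using decides_mono[OF r(3) s(1)] s(2) r(2) by (auto simp: decides_def nth_append less_Suc_eq)
  moreover have "s \<le> q" using s(1) r(1) order_trans by blast
  ultimately show ?case using r(2) by (intro exI[of _ s] conjI exI[of _ "ks @ [n]"]) auto
qed

lemma additive: "inf a b = bot \<Longrightarrow> \<nu> n (sup a b) = \<nu> n a + \<nu> n b"
  using biorthogonal unfolding biorthogonal_null_sequence_def by blast

lemma variation: "sorted_wrt (\<lambda>a b. inf a b = bot) as \<Longrightarrow> (\<Sum>a\<leftarrow>as. \<bar>\<nu> n a\<bar>) \<le> 2"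
  using biorthogonal unfolding biorthogonal_null_sequence_def by blast

lemma null: "(\<lambda>n. \<nu> n a) \<longlonglongrightarrow> 0"
  using biorthogonal unfolding biorthogonal_null_sequence_def by blast

lemma dual: "\<nu> m (d n) = of_bool (m = n)"
  using biorthogonal unfolding biorthogonal_null_sequence_def by blast

text \<open>A name for the measure \<open>2 ^ k * \<nu> (f k)\<close>.\<close>

definition \<mu> :: "nat \<Rightarrow> ('a \<times> rat, 'p) name"
  where "\<mu> k = {((a, q), s). \<exists>n. mem geq (k, n) f s \<and> of_rat q < 2 ^ k * \<nu> n a}"

text \<open>Each pair in \<open>\<mu> k\<close> carries its own value m of f at k; below r
  uniqueness gives m = n, so the measure takes ground model values.\<close>

lemma has_value_\<mu>:
  assumes "r \<le> p\<^sub>0" "mem geq (k, n) f r"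
  shows "has_value (app geq (\<mu> k) a) (2 ^ k * \<nu> n a) r"
  unfolding has_value_def decided_def
proof (intro allI impI iffI)
  fix q s assume s: "s \<le> r" "app geq (\<mu> k) a q s"
  then obtain t u m where t: "t \<le> s" "t \<le> u" "mem geq (k, m) f u" "of_rat q < 2 ^ k * \<nu> m a"
    unfolding app_def mem_def[of _ "(a, q)"] \<mu>_def by (force simp: paireq_def geq_iff)
  have "t \<le> r" using s(1) t(1) order_trans by blast
  then have "t \<le> p\<^sub>0" "mem geq (k, n) f t"
    using assms order_trans mem_stronger[OF assms(2)] by blast+
  then have "m = n" using value_unique mem_stronger[OF t(3,2)] by blast
  with t(4) show "of_rat q < 2 ^ k * \<nu> n a" by simp
next
  fix q s assume s: "s \<le> r" "of_rat q < 2 ^ k * \<nu> n a"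
  have "((a, q), r) \<in> \<mu> k" using s(2) assms(2) unfolding \<mu>_def by blast
  then show "app geq (\<mu> k) a q s"
    unfolding app_def mem_def
  proof (intro allI impI)
    fix t assume "t \<le> s"
    then have "t \<le> r" using s(1) order_trans by blast
    then show "\<exists>r\<le>t. \<exists>(y, s)\<in>\<mu> k. r \<le> s \<and> paireq geq geq (a, q) y r"
      using \<open>((a, q), r) \<in> \<mu> k\<close> by (intro exI[of _ t] conjI bexI[of _ "((a, q), r)"])
        (auto simp: paireq_def geq_iff)
  qed
qed

lemma ba_measure_\<mu>:
  assumes "p \<le> p\<^sub>0" shows "ba_measure (\<mu> k) p"
proof (rule regularD_dense[OF regular_ba_measure])
  fix q assume "q \<le> p"
  then have "q \<le> p\<^sub>0" using assms order_trans by blast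
  then obtain r n where r: "r \<le> q" "mem geq (k, n) f r" using value_exists by blast
  then have "r \<le> p\<^sub>0" using \<open>q \<le> p\<^sub>0\<close> order_trans by blast
  note val = has_value_\<mu>[OF \<open>r \<le> p\<^sub>0\<close> r(2)]
  have "ba_measure (\<mu> k) r"
    unfolding ba_measure_def real_fun_on_def
  proof (intro fAndI)
    show "(\<^bold>\<forall>s q. app geq (\<mu> k) s q \<^bold>\<longrightarrow> ground True) r"
      by (intro fAllI fImpI) simp
    show "(\<^bold>\<forall>s. ground True \<^bold>\<longrightarrow> is_real (app geq (\<mu> k) s)) r"
      by (intro fAllI fImpI has_value_is_real[OF has_value_mono[OF val]])
    show "(\<^bold>\<forall>a b. ground (inf a b = bot) \<^bold>\<longrightarrow>
        req (app geq (\<mu> k) (sup a b)) (radd (app geq (\<mu> k) a) (app geq (\<mu> k) b))) r"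
    proof (intro fAllI fImpI)
      fix a b :: 'a and s assume s: "s \<le> r" "ground (inf a b = bot) s"
      then have "2 ^ k * \<nu> n (sup a b) = 2 ^ k * \<nu> n a + 2 ^ k * \<nu> n b"
        by (simp add: additive distrib_left)
      then show "req (app geq (\<mu> k) (sup a b)) (radd (app geq (\<mu> k) a) (app geq (\<mu> k) b)) s"
        using has_value_mono[OF val s(1)] by (metis has_value_req has_value_radd)
    qed
    show "(\<^bold>\<exists>K. \<^bold>\<forall>as. ground (sorted_wrt (\<lambda>a b. inf a b = bot) as) \<^bold>\<longrightarrow>
        rle (rsum (map (\<lambda>a. rabs (app geq (\<mu> k) a)) as)) (rconst K)) r"
    proof (rule fExI[where x = "2 ^ k * 2"], intro fAllI fImpI)
      fix t s and as :: "'a list"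
      assume s: "t \<le> r" "s \<le> t" "ground (sorted_wrt (\<lambda>a b. inf a b = bot) as) s"
      then have "s \<le> r" using order_trans by blast
      show "rle (rsum (map (\<lambda>a. rabs (app geq (\<mu> k) a)) as)) (rconst (2 ^ k * 2)) s"
      proof (rule has_value_rle[OF has_value_rsum has_value_rconst])
        show "has_value (rabs (app geq (\<mu> k) a)) \<bar>2 ^ k * \<nu> n a\<bar> s" for a
          by (intro has_value_rabs has_value_mono[OF val \<open>s \<le> r\<close>])
        show "(\<Sum>a\<leftarrow>as. \<bar>2 ^ k * \<nu> n a\<bar>) \<le> of_rat (2 ^ k * 2)"
          using variation[of as n] s(3) by (simp add: abs_mult sum_list_const_mult of_rat_mult of_rat_power)
      qed
    qed
  qed
  with r(1) show "\<exists>r\<le>q. ba_measure (\<mu> k) r" by blast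
qed

lemma pointwise_null_\<mu>:
  assumes "p \<le> p\<^sub>0" shows "pointwise_null \<mu> p"
  unfolding pointwise_null_def
proof (rule fAllI, rule fAllI, rule fImpI)
  fix a and \<epsilon> :: rat and q assume q: "q \<le> p" "ground (0 < \<epsilon>) q"
  have "\<exists>M. \<forall>m\<ge>M. \<bar>\<nu> m a\<bar> < 1 / 4 ^ k" for k :: nat
    using LIMSEQ_D[OF null[of a], of "1 / 4 ^ k"] by simp
  \<comment> \<open>The threshold function of a lies in the ground model, so f eventually dominates
    it.\<close>
  then obtain g where g: "\<And>k m. m \<ge> g k \<Longrightarrow> \<bar>\<nu> m a\<bar> < 1 / 4 ^ k" by metis
  show "(\<^bold>\<exists>N. \<^bold>\<forall>n. ground (N \<le> n) \<^bold>\<longrightarrow> rless (rabs (app geq (\<mu> n) a)) (rconst \<epsilon>)) q"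
  proof (rule fExI_dense)
    fix q' assume "q' \<le> q"
    then have "q' \<le> p\<^sub>0" using q(1) assms order_trans by blast
    from eventually_dominates[OF this, of g] obtain r N where r: "r \<le> q'"
        "\<And>n k s. N \<le> n \<Longrightarrow> s \<le> r \<Longrightarrow> mem geq (n, k) f s \<Longrightarrow> g n \<le> k" by blast
    obtain N' where N': "(1 / 2 :: real) ^ N' < of_rat \<epsilon>"
      using real_arch_pow_inv[of "of_rat \<epsilon>" "1 / 2 :: real"] q(2) by auto
    \<comment> \<open>From N on f dominates g, and from N' on \<open>(1 / 2) ^ n\<close> is below
      \<epsilon>.\<close>
    have "(\<^bold>\<forall>n. ground (max N N' \<le> n) \<^bold>\<longrightarrow> rless (rabs (app geq (\<mu> n) a)) (rconst \<epsilon>)) r"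
    proof (rule fAllI, rule fImpI_dense)
      fix n s assume s: "s \<le> r" "ground (max N N' \<le> n) s"
      then have "s \<le> p\<^sub>0" using r(1) \<open>q' \<le> p\<^sub>0\<close> order_trans by blast
      then obtain t k where t: "t \<le> s" "mem geq (n, k) f t" using value_exists by blast
      have "t \<le> p\<^sub>0" "t \<le> r" using t(1) s(1) \<open>s \<le> p\<^sub>0\<close> order_trans by blast+
      then have "\<bar>\<nu> k a\<bar> < 1 / 4 ^ n" using g r(2) t(2) s(2) by simp
      then have "\<bar>2 ^ n * \<nu> k a\<bar> < 2 ^ n * (1 / 4 ^ n)"
        unfolding abs_mult by (simp add: mult_strict_left_mono del: times_divide_eq_right)
      also have "\<dots> = (2 / 4) ^ n" by (simp only: power_divide times_divide_eq_right mult_1_right)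
      also have "\<dots> = (1 / 2) ^ n" by simp
      also have "\<dots> \<le> (1 / 2) ^ N'" using s(2) by (intro power_decreasing) auto
      also note N'
      finally have "rless (rabs (app geq (\<mu> n) a)) (rconst \<epsilon>) t"
        by (rule has_value_rless[OF has_value_rabs[OF has_value_\<mu>[OF \<open>t \<le> p\<^sub>0\<close> t(2)]] has_value_rconst])
      with t(1) show "\<exists>r\<le>s. rless (rabs (app geq (\<mu> n) a)) (rconst \<epsilon>) r" by blast
    qed
    with r(1) show "\<exists>r\<le>q'. \<exists>N. (\<^bold>\<forall>n. ground (N \<le> n) \<^bold>\<longrightarrow> rless (rabs (app geq (\<mu> n) a)) (rconst \<epsilon>)) r"
      by blast
  qed
qed

text \<open>
  A name for the function \<open>\<Sum>j. 2 ^ - j * \<chi> (d (f j))\<close>: a rational is below its value at \<open>U\<close> iff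
  it is below the value of a partial sum.
\<close>

definition below_phi :: "('a, 'p) point \<Rightarrow> rat \<Rightarrow> 'p sentence"
  where "below_phi U q = (ultrafilter U \<^bold>\<and>
    (\<lambda>p. \<forall>p'\<le>p. \<exists>r\<le>p'. \<exists>ks. decides ks r \<and> q < weight (\<lambda>a. mem geq a U r) (map d ks) 1))"

definition phi :: "(('a, 'p) point \<times> rat, 'p) name"
  where "phi = {(x, s). below_phi (fst x) (snd x) s}"

lemma regular_below_phi: "regular (below_phi U q)"
  unfolding below_phi_def by (intro regular_fAnd regular_ultrafilter regular_dense_closure)

text \<open>The point is that \<open>below_phi\<close> respects forced equality of points, as it
  depends only on their members.\<close>

lemma app_phi: "app (seteq geq) phi U q p \<longleftrightarrow> below_phi U q p"
proof -
  have "mem (paireq (seteq geq) geq) (U, q) {(x, s). below_phi (fst x) (snd x) s} p \<longleftrightarrow>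
      below_phi (fst (U, q)) (snd (U, q)) p"
  proof (rule mem_Collect[where \<Psi> = "\<lambda>x. below_phi (fst x) (snd x)"])
    show "regular (below_phi (fst (U, q)) (snd (U, q)))" by (rule regular_below_phi)
    show "below_phi (fst y) (snd y) r" if "below_phi (fst y) (snd y) s" "r \<le> s" for y r s
      using regularD_mono[OF regular_below_phi that] .
    show "paireq (seteq geq) geq (U, q) (U, q) r" for r
      by (simp add: paireq_def geq_iff seteq_refl)
    fix y r assume y: "paireq (seteq geq) geq (U, q) y r" "below_phi (fst y) (snd y) r"
    obtain W where W: "y = (W, q)" "seteq geq U W r"
      using y(1) by (cases y) (auto simp: paireq_def geq_iff)
    have eq: "mem geq a U s \<longleftrightarrow> mem geq a W s" if "s \<le> r" for a s
      using W(2) that unfolding seteq_iff by blast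
    have "below_phi U q r"
      unfolding below_phi_def fAnd_iff
    proof (intro conjI allI impI)
      show "ultrafilter U r" using y(2) W ultrafilter_cong[of U W r] by (simp add: below_phi_def)
      fix p' assume "p' \<le> r"
      then obtain s ks where s: "s \<le> p'" "decides ks s" "q < weight (\<lambda>a. mem geq a W s) (map d ks) 1"
        using y(2) W(1) by (auto simp: below_phi_def)
      have "s \<le> r" using s(1) \<open>p' \<le> r\<close> order_trans by blast
      then have "q < weight (\<lambda>a. mem geq a U s) (map d ks) 1" using s(3) by (simp add: eq)
      with s(1,2) show "\<exists>s\<le>p'. \<exists>ks. decides ks s \<and> q < weight (\<lambda>a. mem geq a U s) (map d ks) 1"
        by (intro exI conjI)
    qed
    then show "below_phi (fst (U, q)) (snd (U, q)) r" by simp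
  qed
  then show ?thesis by (simp add: app_def phi_def)
qed

text \<open>Forced memberships persist, so weights only grow when conditions get stronger, and one
  good condition serves for everything below it.\<close>

lemma below_phiI:
  assumes "ultrafilter U r" "decides ks r" "q < weight (\<lambda>a. mem geq a U r) (map d ks) 1"
  shows "below_phi U q r"
  unfolding below_phi_def fAnd_iff
proof (intro conjI allI impI)
  fix s assume "s \<le> r"
  have "q < weight (\<lambda>a. mem geq a U s) (map d ks) 1"
    using assms(3) weight_mono[of 1 "\<lambda>a. mem geq a U r" "\<lambda>a. mem geq a U s" "map d ks"]
      mem_stronger[OF _ \<open>s \<le> r\<close>, of geq _ U] by simp
  then show "\<exists>s'\<le>s. \<exists>ks. decides ks s' \<and> q < weight (\<lambda>a. mem geq a U s') (map d ks) 1"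
    using decides_mono[OF assms(2) \<open>s \<le> r\<close>] by blast
qed (rule assms(1))

text \<open>Lists decided further below r agree with ks on common indices, so a partial sum at a
  point of the piece a exceeds c by at most the tail.\<close>

lemma cut_between_phi:
  assumes "r \<le> p\<^sub>0" "ultrafilter U r" "decides ks r"
    and piece: "(a, c) \<in> set (pieces (map d ks) 1)" and "mem geq a U r"
  shows "cut_between (app (seteq geq) phi U) c (2 / 2 ^ length ks) r"
  unfolding cut_between_def app_phi
proof (intro allI impI conjI)
  fix q s assume s: "s \<le> r"
  have U: "ultrafilter U s" using ultrafilter_stronger[OF assms(2) s] .
  show "below_phi U q s" if "q < c"
  proof (rule below_phiI[OF U decides_mono[OF assms(3) s]])
    have "c \<le> weight (\<lambda>a. mem geq a U s) (map d ks) 1"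
      by (rule pieces_lower[OF piece]) (use mem_stronger[OF assms(5) s] ultrafilter_mono[OF U] in auto)
    with that show "q < weight (\<lambda>a. mem geq a U s) (map d ks) 1" by simp
  qed
  assume "below_phi U q s"
  then obtain t ks' where t: "t \<le> s" "decides ks' t" "q < weight (\<lambda>a. mem geq a U t) (map d ks') 1"
    unfolding below_phi_def by auto
  have "t \<le> r" "t \<le> p\<^sub>0" using t(1) s assms(1) order_trans by blast+
  have U': "ultrafilter U t" using ultrafilter_stronger[OF U t(1)] .
  have "weight (\<lambda>a. mem geq a U t) (map d ks') 1 \<le> c + 2 * 1 / 2 ^ length (map d ks)"
  proof (rule pieces_upper[OF piece])
    show "mem geq a U t" using mem_stronger[OF assms(5) \<open>t \<le> r\<close>] .
    show "\<forall>j. j < length (map d ks) \<and> j < length (map d ks') \<longrightarrow> map d ks ! j = map d ks' ! j"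
    proof (intro allI impI)
      fix j assume j: "j < length (map d ks) \<and> j < length (map d ks')"
      then have "ks ! j = ks' ! j"
        using decides_mono[OF assms(3) \<open>t \<le> r\<close>] t(2) value_unique[OF \<open>t \<le> p\<^sub>0\<close>]
        unfolding decides_def by auto
      with j show "map d ks ! j = map d ks' ! j" by simp
    qed
    show "mem geq b U t" if "mem geq a U t" "a \<le> b" for a b
      using ultrafilter_mono[OF U' that] .
    show "\<not> mem geq b U t" if "mem geq (- b) U t" for b
      using ultrafilter_disjoint[OF U' that] by simp
  qed simp
  with t(3) show "q < c + 2 / 2 ^ length ks" by simp
qed

lemma is_real_phi:
  assumes "r \<le> p\<^sub>0" "ultrafilter U r"
  shows "is_real (app (seteq geq) phi U) r"
proof -
  let ?x = "app (seteq geq) phi U"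
  \<comment> \<open>The empty list has the single piece \<open>top\<close> with value 0, which
    yields the global bounds 0 and 2.\<close>
  have "cut_between ?x 0 (2 / 2 ^ length ([] :: nat list)) r"
    by (rule cut_between_phi[where a = top])
      (use assms in \<open>auto simp: decides_def ultrafilter_iff\<close>)
  then have bounds: "\<And>q s. s \<le> r \<Longrightarrow> q < 0 \<Longrightarrow> ?x q s" "\<And>q s. s \<le> r \<Longrightarrow> ?x q s \<Longrightarrow> q < 2"
    by (auto simp: cut_between_def)
  show ?thesis
    unfolding is_real_def
  proof (intro fAndI)
    show "(\<^bold>\<exists>q. ?x q) r" by (rule fExI[where x = "- 1"]) (simp add: bounds(1))
    show "(\<^bold>\<exists>q. \<^bold>\<not> ?x q) r"
    proof (rule fExI[where x = 2])
      fix s assume "s \<le> r"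
      then have "\<not> ?x 2 t" if "t \<le> s" for t using bounds(2)[of t 2] order_trans[OF that] by auto
      then show "(\<^bold>\<not> ?x 2) s" by (simp add: fNot_iff)
    qed
    show "(\<^bold>\<forall>q q'. ground (q' < q) \<^bold>\<and> ?x q \<^bold>\<longrightarrow> ?x q') r"
    proof (rule fAllI, rule fAllI, rule fImpI)
      fix q q' s assume "(ground (q' < q) \<^bold>\<and> ?x q) s"
      then have "q' < q" "below_phi U q s" by (simp_all add: app_phi)
      then show "?x q' s" unfolding app_phi below_phi_def fAnd_iff by (meson less_trans)
    qed
    show "(\<^bold>\<forall>q. ?x q \<^bold>\<longrightarrow> (\<^bold>\<exists>q'. ground (q < q') \<^bold>\<and> ?x q')) r"
    proof (rule fAllI, rule fImpI, rule fExI_dense)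
      fix q s t assume s: "s \<le> r" "?x q s" "t \<le> s"
      then obtain u ks where u: "u \<le> t" "decides ks u" "q < weight (\<lambda>a. mem geq a U u) (map d ks) 1"
        unfolding app_phi below_phi_def by auto
      then obtain q' where q': "q < q'" "q' < weight (\<lambda>a. mem geq a U u) (map d ks) 1"
        using dense by blast
      have "u \<le> r" using u(1) s(1,3) order_trans by blast
      then have "below_phi U q' u"
        using below_phiI[OF ultrafilter_stronger[OF assms(2)] u(2) q'(2)] by blast
      with u(1) q'(1) show "\<exists>u\<le>t. \<exists>q'. (ground (q < q') \<^bold>\<and> ?x q') u" by (auto simp: app_phi)
    qed
  qed
qed

lemma stone_continuous_phi:
  assumes "p \<le> p\<^sub>0" shows "stone_continuous phi p"
  unfolding stone_continuous_def real_fun_on_def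
proof (intro fAndI)
  show "(\<^bold>\<forall>U q. app (seteq geq) phi U q \<^bold>\<longrightarrow> ultrafilter U) p"
    by (intro fAllI fImpI) (simp add: app_phi below_phi_def)
  show "(\<^bold>\<forall>U. ultrafilter U \<^bold>\<longrightarrow> is_real (app (seteq geq) phi U)) p"
    using assms order_trans by (intro fAllI fImpI is_real_phi) blast+
  show "(\<^bold>\<forall>U \<epsilon>. ultrafilter U \<^bold>\<and> ground (0 < \<epsilon>) \<^bold>\<longrightarrow>
        (\<^bold>\<exists>a. mem geq a U \<^bold>\<and>
          (\<^bold>\<forall>W. ultrafilter W \<^bold>\<and> mem geq a W \<^bold>\<longrightarrow>
             rless (rabs (rdiff (app (seteq geq) phi W) (app (seteq geq) phi U))) (rconst \<epsilon>)))) p"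
  proof (rule fAllI, rule fAllI, rule fImpI, rule fExI_dense)
    fix U :: "('a, 'p) point" and \<epsilon> :: rat and q q'
    assume q: "q \<le> p" "(ultrafilter U \<^bold>\<and> ground (0 < \<epsilon>)) q" "q' \<le> q"
    then have "q' \<le> p\<^sub>0" using assms order_trans by blast
    obtain J where J: "2 / 2 ^ J < \<epsilon>" using ex_pow_half_less[of \<epsilon> 0] q(2) by auto
    obtain r ks where r: "r \<le> q'" "length ks = J" "decides ks r"
      using decides_exists[OF \<open>q' \<le> p\<^sub>0\<close>] by blast
    have "r \<le> q" using r(1) q(3) order_trans by blast
    then have "ultrafilter U r" using q(2) ultrafilter_stronger by auto
    \<comment> \<open>The piece containing U is the required neighbourhood: on it all values of
      \<open>phi\<close> lie in one interval of length 2 / \<open>2 ^ J\<close>.\<close>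
    from pieces_cover[OF this, of "map d ks" 1] obtain s a c where s: "s \<le> r"
        "(a, c) \<in> set (pieces (map d ks) 1)" "mem geq a U s" by auto
    have "s \<le> p\<^sub>0" using s(1) r(1) \<open>q' \<le> p\<^sub>0\<close> order_trans by blast
    have U: "cut_between (app (seteq geq) phi U) c (2 / 2 ^ length ks) s"
      using cut_between_phi[OF \<open>s \<le> p\<^sub>0\<close> ultrafilter_stronger[OF \<open>ultrafilter U r\<close> s(1)]
          decides_mono[OF r(3) s(1)] s(2,3)] .
    have "(\<^bold>\<forall>W. ultrafilter W \<^bold>\<and> mem geq a W \<^bold>\<longrightarrow>
        rless (rabs (rdiff (app (seteq geq) phi W) (app (seteq geq) phi U))) (rconst \<epsilon>)) s"
    proof (rule fAllI, rule fImpI)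
      fix W :: "('a, 'p) point" and t assume t: "t \<le> s" "(ultrafilter W \<^bold>\<and> mem geq a W) t"
      then have "t \<le> p\<^sub>0" "t \<le> r" using \<open>s \<le> p\<^sub>0\<close> s(1) order_trans by blast+
      then have W: "cut_between (app (seteq geq) phi W) c (2 / 2 ^ length ks) t"
        using cut_between_phi[OF _ _ decides_mono[OF r(3)] s(2)] t(2) by simp
      show "rless (rabs (rdiff (app (seteq geq) phi W) (app (seteq geq) phi U))) (rconst \<epsilon>) t"
        unfolding rless_def
      \<comment> \<open>\<open>rless\<close> asks for a rational below \<epsilon> that is not below
        the absolute difference; the length of the common interval is one.\<close>
      proof (rule fExI[where x = "2 / 2 ^ length ks"])
        fix u assume "u \<le> t"
        have "\<not> rabs (rdiff (app (seteq geq) phi W) (app (seteq geq) phi U)) (2 / 2 ^ length ks) v"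
          if "v \<le> u" for v
        proof -
          have "v \<le> t" "v \<le> s" using that \<open>u \<le> t\<close> t(1) order_trans by blast+
          with cut_between_rdiff[OF cut_between_mono[OF W] cut_between_mono[OF U]] show ?thesis
            by (metis less_irrefl)
        qed
        then show "((\<^bold>\<not> rabs (rdiff (app (seteq geq) phi W) (app (seteq geq) phi U)) (2 / 2 ^ length ks))
            \<^bold>\<and> rconst \<epsilon> (2 / 2 ^ length ks)) u"
          using J r(2) by (simp add: fNot_iff rconst_def)
      qed
    qed
    with s(3) have "(mem geq a U \<^bold>\<and> (\<^bold>\<forall>W. ultrafilter W \<^bold>\<and> mem geq a W \<^bold>\<longrightarrow>
        rless (rabs (rdiff (app (seteq geq) phi W) (app (seteq geq) phi U))) (rconst \<epsilon>))) s"
      by (intro fAndI)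
    moreover have "s \<le> q'" using s(1) r(1) order_trans by blast
    ultimately show "\<exists>s\<le>q'. \<exists>a. (mem geq a U \<^bold>\<and> (\<^bold>\<forall>W. ultrafilter W \<^bold>\<and> mem geq a W \<^bold>\<longrightarrow>
        rless (rabs (rdiff (app (seteq geq) phi W) (app (seteq geq) phi U))) (rconst \<epsilon>))) s"
      by blast
  qed
qed

text \<open>The Radon measure m is an arbitrary name, but \<open>\<mu> k\<close> pins down its
  values on clopen sets, and the simple functions that will approximate \<open>phi\<close> live on
  clopen pieces.\<close>

lemma has_value_clopen:
  assumes "r \<le> p\<^sub>0" "mem geq (k, n) f r" "extends_measure m (\<mu> k) r"
  shows "has_value (sval m (clopen a)) (2 ^ k * \<nu> n a) r"
proof -
  let ?def = "\<^bold>\<forall>U. pmem U (clopen a) \<^bold>\<longleftrightarrow> ultrafilter U \<^bold>\<and> mem geq a U"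
  have imp: "(?def \<^bold>\<longrightarrow> req (sval m (clopen a)) (app geq (\<mu> k) a)) r"
    using assms(3) unfolding extends_measure_def by simp
  have reg: "regular ?def" "regular (req (sval m (clopen a)) (app geq (\<mu> k) a))"
    unfolding sval_def by (intro regular_intros)+
  have "?def r"
    by (intro fAllI) (simp add: fIff_iff regular_intros pmem_clopen)
  with fImpD[OF imp reg order_refl] have "req (sval m (clopen a)) (app geq (\<mu> k) a) r" .
  then show ?thesis
    by (rule req_has_value[OF _ has_value_\<mu>[OF assms(1,2)]]) (auto simp: sval_def intro: regular_intros)
qed

text \<open>With 1/4 as the bound both for the integral and for its approximation, a simple function
  near \<open>phi\<close> would have a sum below 1/2, while biorthogonality makes that sum at least
  1.\<close>

lemma not_weak_star_null:
  assumes "p \<le> p\<^sub>0" shows "\<not> weak_star_null \<mu> p"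
proof
  assume weak: "weak_star_null \<mu> p"
  define body where "body n = (\<^bold>\<exists>m (I :: (rat, 'p) name).
      radon_measure m \<^bold>\<and> extends_measure m (\<mu> n) \<^bold>\<and>
      is_real (\<lambda>q. mem geq q I) \<^bold>\<and> has_stone_integral phi m (\<lambda>q. mem geq q I) \<^bold>\<and>
      rless (rabs (\<lambda>q. mem geq q I)) (rconst (1 / 4)))" for n
  have "(stone_continuous phi \<^bold>\<and> ground (0 < (1 / 4 :: rat)) \<^bold>\<longrightarrow>
      (\<^bold>\<exists>N. \<^bold>\<forall>n. ground (N \<le> n) \<^bold>\<longrightarrow> body n)) p"
    using fAllD[OF fAllD[OF weak[unfolded weak_star_null_def], of phi], of "1 / 4"]
    unfolding body_def .
  moreover have "(stone_continuous phi \<^bold>\<and> ground (0 < (1 / 4 :: rat))) p"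
    using stone_continuous_phi[OF assms] by simp
  ultimately obtain r\<^sub>1 where r\<^sub>1: "r\<^sub>1 \<le> p" "(\<^bold>\<exists>N. \<^bold>\<forall>n. ground (N \<le> n) \<^bold>\<longrightarrow> body n) r\<^sub>1"
    by (rule fImpE)
  from r\<^sub>1(2) obtain r\<^sub>2 N where r\<^sub>2: "r\<^sub>2 \<le> r\<^sub>1" "(\<^bold>\<forall>n. ground (N \<le> n) \<^bold>\<longrightarrow> body n) r\<^sub>2"
    by (rule fExE)
  \<comment> \<open>The threshold N itself is the index of the measure to be refuted.\<close>
  from fAllD[OF r\<^sub>2(2), of N] obtain r\<^sub>3 where r\<^sub>3: "r\<^sub>3 \<le> r\<^sub>2" "body N r\<^sub>3"
    by (rule fImpE) simp_all
  from r\<^sub>3(2)[unfolded body_def] obtain r\<^sub>4 m and I :: "(rat, 'p) name" where r\<^sub>4: "r\<^sub>4 \<le> r\<^sub>3"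
      "extends_measure m (\<mu> N) r\<^sub>4" "has_stone_integral phi m (\<lambda>q. mem geq q I) r\<^sub>4"
      "rless (rabs (\<lambda>q. mem geq q I)) (rconst (1 / 4)) r\<^sub>4"
    by (elim fExE) (simp, meson order_trans)
  define simple where "simple \<delta> bs = (disjoint_borel_list (map fst bs) \<^bold>\<and>
      (\<^bold>\<forall>U. ultrafilter U \<^bold>\<longrightarrow> (\<^bold>\<exists>i. ground (i < length bs) \<^bold>\<and> pmem U (fst (bs ! i)))) \<^bold>\<and>
      (\<^bold>\<forall>i U. ground (i < length bs) \<^bold>\<and> pmem U (fst (bs ! i)) \<^bold>\<longrightarrow>
        rle (rabs (rdiff (app (seteq geq) phi U) (rconst (snd (bs ! i))))) (rconst \<delta>)))"
    for \<delta> :: rat and bs :: "(('a, 'p) pointset \<times> rat) list"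
  define close where "close bs = rless (rabs (rdiff
      (rsum (map (\<lambda>(B, c). rmult (rconst c) (sval m B)) bs)) (\<lambda>q. mem geq q I))) (rconst (1 / 4))" for bs
  have "(ground (0 < (1 / 4 :: rat)) \<^bold>\<longrightarrow>
      (\<^bold>\<exists>\<delta>. ground (0 < \<delta>) \<^bold>\<and> (\<^bold>\<forall>bs. simple \<delta> bs \<^bold>\<longrightarrow> close bs))) r\<^sub>4"
    using fAllD[OF r\<^sub>4(3)[unfolded has_stone_integral_def], of "1 / 4"]
    unfolding simple_def close_def fImp_def fAnd_def .
  then obtain r\<^sub>5 where r\<^sub>5: "r\<^sub>5 \<le> r\<^sub>4"
      "(\<^bold>\<exists>\<delta>. ground (0 < \<delta>) \<^bold>\<and> (\<^bold>\<forall>bs. simple \<delta> bs \<^bold>\<longrightarrow> close bs)) r\<^sub>5"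
    by (rule fImpE) simp_all
  from r\<^sub>5(2) obtain r\<^sub>6 \<delta> where r\<^sub>6: "r\<^sub>6 \<le> r\<^sub>5" "0 < \<delta>" "(\<^bold>\<forall>bs. simple \<delta> bs \<^bold>\<longrightarrow> close bs) r\<^sub>6"
    by (rule fExE) (auto simp only: fAnd_iff ground_iff)
  have "r\<^sub>6 \<le> r\<^sub>4" "r\<^sub>6 \<le> p\<^sub>0"
    using r\<^sub>1(1) r\<^sub>2(1) r\<^sub>3(1) r\<^sub>4(1) r\<^sub>5(1) r\<^sub>6(1) assms by (meson order_trans)+
  \<comment> \<open>J > N puts the value of f at N among the decided ones; 2 / \<open>2 ^ J\<close>
    < \<delta> makes the partial sum an admissible approximation of \<open>phi\<close>.\<close>
  obtain J where J: "J \<ge> Suc N" "2 / 2 ^ J < \<delta>" using ex_pow_half_less[OF r\<^sub>6(2)] by blast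
  obtain r\<^sub>7 ks where r\<^sub>7: "r\<^sub>7 \<le> r\<^sub>6" "length ks = J" "decides ks r\<^sub>7"
    using decides_exists[OF \<open>r\<^sub>6 \<le> p\<^sub>0\<close>] by blast
  have "r\<^sub>7 \<le> r\<^sub>4" "r\<^sub>7 \<le> p\<^sub>0" using r\<^sub>7(1) \<open>r\<^sub>6 \<le> r\<^sub>4\<close> \<open>r\<^sub>6 \<le> p\<^sub>0\<close> order_trans by blast+
  define P where "P = pieces (map d ks) 1"
  define bs :: "(('a, 'p) pointset \<times> rat) list" where "bs = map (\<lambda>(a, c). (clopen a, c)) P"
  have len: "length bs = length P" by (simp add: bs_def)
  have nth: "bs ! i = (clopen (fst (P ! i)), snd (P ! i))" if "i < length P" for i
    using that by (simp add: bs_def case_prod_beta)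
  have "simple \<delta> bs r\<^sub>7"
    unfolding simple_def
  proof (intro fAndI)
    show "disjoint_borel_list (map fst bs) r\<^sub>7"
      unfolding disjoint_borel_list_def
    proof (intro fAndI fAllI fImpI)
      fix i and s :: 'p assume "ground (i < length (map fst bs)) s"
      then show "stone_borel (map fst bs ! i) s" by (simp add: len nth stone_borel_clopen)
    next
      fix i j and s :: 'p assume "ground (i < j \<and> j < length (map fst bs)) s"
      then have ij: "i < j" "j < length P" by (simp_all add: len)
      then have "inf (fst (P ! i)) (fst (P ! j)) = bot"
        using pieces_disjoint[of "map d ks" 1] unfolding P_def[symmetric]
        by (simp add: sorted_wrt_iff_nth_less)
      then have "\<not> (mem geq (fst (P ! i)) U t \<and> mem geq (fst (P ! j)) U t)"
        if "ultrafilter U t" for U and t :: 'p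
        using ultrafilter_disjoint[OF that] by blast
      with ij show "pdisjoint (map fst bs ! i) (map fst bs ! j) s"
        unfolding pdisjoint_def by (auto simp: fNot_iff len nth pmem_clopen)
    qed
    show "(\<^bold>\<forall>U. ultrafilter U \<^bold>\<longrightarrow> (\<^bold>\<exists>i. ground (i < length bs) \<^bold>\<and> pmem U (fst (bs ! i)))) r\<^sub>7"
    proof (rule fAllI, rule fImpI, rule fExI_dense)
      fix U :: "('a, 'p) point" and s t assume "ultrafilter U s" "t \<le> s"
      then have "ultrafilter U t" by (rule ultrafilter_stronger)
      from pieces_cover[OF this] obtain u x where u: "u \<le> t" "x \<in> set P" "mem geq (fst x) U u"
        unfolding P_def by blast
      from u(2) obtain i where "i < length P" "P ! i = x" by (auto simp: in_set_conv_nth)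
      then show "\<exists>u\<le>t. \<exists>i. (ground (i < length bs) \<^bold>\<and> pmem U (fst (bs ! i))) u"
        using u ultrafilter_stronger[OF \<open>ultrafilter U t\<close> u(1)]
        by (intro exI[of _ u] conjI exI[of _ i]) (auto simp: len nth pmem_clopen)
    qed
    show "(\<^bold>\<forall>i U. ground (i < length bs) \<^bold>\<and> pmem U (fst (bs ! i)) \<^bold>\<longrightarrow>
        rle (rabs (rdiff (app (seteq geq) phi U) (rconst (snd (bs ! i))))) (rconst \<delta>)) r\<^sub>7"
    proof (rule fAllI, rule fAllI, rule fImpI)
      fix i and U :: "('a, 'p) point" and s
      assume s: "s \<le> r\<^sub>7" "(ground (i < length bs) \<^bold>\<and> pmem U (fst (bs ! i))) s"
      obtain a c where ac: "P ! i = (a, c)" by fastforce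
      have i: "i < length P" "ultrafilter U s" "mem geq a U s"
        using s(2) ac by (auto simp: len nth pmem_clopen)
      have "(a, c) \<in> set (pieces (map d ks) 1)" using i(1) ac unfolding P_def by (metis nth_mem)
      from cut_between_phi[OF order_trans[OF s(1) \<open>r\<^sub>7 \<le> p\<^sub>0\<close>] i(2) decides_mono[OF r\<^sub>7(3) s(1)] this i(3)]
      have between: "cut_between (app (seteq geq) phi U) c (2 / 2 ^ length ks) s" .
      show "rle (rabs (rdiff (app (seteq geq) phi U) (rconst (snd (bs ! i))))) (rconst \<delta>) s"
        unfolding rle_def
      proof (rule fAllI, rule fImpI)
        fix q t assume t: "t \<le> s" "rabs (rdiff (app (seteq geq) phi U) (rconst (snd (bs ! i)))) q t"
        have "q < 2 / 2 ^ length ks"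
          using cut_between_rdiff[OF cut_between_mono[OF between t(1)] cut_between_rconst]
            t(2) nth[OF i(1)] ac by simp
        then show "rconst \<delta> q t" using J(2) r\<^sub>7(2) by (simp add: rconst_def)
      qed
    qed
  qed
  with fAllD[OF r\<^sub>6(3), of bs] r\<^sub>7(1) obtain r\<^sub>8 where r\<^sub>8: "r\<^sub>8 \<le> r\<^sub>7" "close bs r\<^sub>8"
    unfolding fImp_iff[of _ _ r\<^sub>6] by blast
  have "r\<^sub>8 \<le> r\<^sub>4" using r\<^sub>8(1) \<open>r\<^sub>7 \<le> r\<^sub>4\<close> order_trans by blast
  \<comment> \<open>The integral I stays undecided; only a rational \<open>q\<^sub>0\<close> < 1/4
    bounding it from above is fixed.\<close>
  from regularD_mono[OF regular_rless r\<^sub>4(4) this] obtain q\<^sub>0 r\<^sub>9 where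
      r\<^sub>9: "r\<^sub>9 \<le> r\<^sub>8" "q\<^sub>0 < 1 / 4" "cut_ge (rminus (\<lambda>q. mem geq q I)) (- of_rat q\<^sub>0) r\<^sub>9"
    by (rule rless_rabs_cut_ge_rminus) (auto intro: regular_intros)
  have "r\<^sub>9 \<le> r\<^sub>7" "r\<^sub>9 \<le> p\<^sub>0" "r\<^sub>9 \<le> r\<^sub>4"
    using r\<^sub>9(1) r\<^sub>8(1) \<open>r\<^sub>7 \<le> p\<^sub>0\<close> \<open>r\<^sub>7 \<le> r\<^sub>4\<close> by (meson order_trans)+
  let ?v = "\<lambda>a. 2 ^ N * \<nu> (ks ! N) a"
  have dec: "mem geq (N, ks ! N) f r\<^sub>9"
    using decides_mono[OF r\<^sub>7(3) \<open>r\<^sub>9 \<le> r\<^sub>7\<close>] r\<^sub>7(2) J(1) by (simp add: decides_def)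
  have "extends_measure m (\<mu> N) r\<^sub>9"
    using r\<^sub>4(2) \<open>r\<^sub>9 \<le> r\<^sub>4\<close> by (rule regularD_mono[OF regular_extends_measure])
  note val = has_value_clopen[OF \<open>r\<^sub>9 \<le> p\<^sub>0\<close> dec this]
  have "cut_ge (rsum (map (\<lambda>x. rmult (rconst (snd x)) (sval m (clopen (fst x)))) P))
      (\<Sum>x\<leftarrow>P. of_rat (snd x) * ?v (fst x)) r\<^sub>9"
    by (intro cut_ge_rsum cut_ge_rmult_rconst val)
  then have "cut_ge (rsum (map (\<lambda>(B, c). rmult (rconst c) (sval m B)) bs))
      (\<Sum>x\<leftarrow>P. of_rat (snd x) * ?v (fst x)) r\<^sub>9"
    by (simp add: bs_def comp_def case_prod_beta)
  from cut_ge_rless_rabs[OF cut_ge_radd[OF this r\<^sub>9(3)]] regularD_mono[OF regular_rless r\<^sub>8(2)[unfolded close_def] r\<^sub>9(1)]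
  have "(\<Sum>x\<leftarrow>P. of_rat (snd x) * ?v (fst x)) + - of_rat q\<^sub>0 < of_rat (1 / 4)"
    unfolding rdiff_def by blast
  moreover have "(of_rat q\<^sub>0 :: real) < of_rat (1 / 4)" using r\<^sub>9(2) by (simp only: of_rat_less)
  moreover have "1 \<le> (\<Sum>x\<leftarrow>P. of_rat (snd x) * ?v (fst x))"
  proof -
    have "(\<Sum>x\<leftarrow>P. of_rat (snd x) * ?v (fst x)) =
        (\<Sum>j<length (map d ks). of_rat 1 / 2 ^ j * ?v (map d ks ! j))"
      unfolding P_def by (rule pieces_weighted_sum) (simp add: additive distrib_left)
    \<comment> \<open>By biorthogonality the other terms are 0, or positive where f repeats its
      value at N; the term at N is \<open>2 ^ N\<close> / \<open>2 ^ N\<close> = 1.\<close>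
    also have "\<dots> \<ge> (\<Sum>j\<in>{N}. of_rat 1 / 2 ^ j * ?v (map d ks ! j))"
      using r\<^sub>7(2) J(1) by (intro sum_mono2) (auto simp: dual)
    finally show ?thesis using r\<^sub>7(2) J(1) by (simp add: dual)
  qed
  ultimately show False by (simp add: of_rat_divide)
qed

end

theorem theorem1p3:
  assumes "infinite (UNIV :: 'a::boolean_algebra set)"
    and "adds_dominating_real TYPE('p::preorder)"
  shows "forced (\<^bold>\<not> nikodym_property TYPE('a) :: 'p sentence)"
  unfolding forced_def fNot_iff
proof (intro allI impI notI)
  fix p q :: 'p assume nik: "nikodym_property TYPE('a) q"
  obtain \<nu> and d :: "nat \<Rightarrow> 'a" where bi: "biorthogonal_null_sequence \<nu> d"
    using ex_biorthogonal_null_sequence[OF assms(1)] by auto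
  have "(\<^bold>\<exists>f. baire_real f \<^bold>\<and> dominating_over_V f) q"
    using assms(2) unfolding adds_dominating_real_def forced_def by simp
  then obtain f r where r: "r \<le> q" "baire_real f r" "dominating_over_V f r"
    by (rule fExE) auto
  interpret dominating_name f r \<nu> d
    by unfold_locales (use r bi in auto)
  have "((\<^bold>\<forall>n. ba_measure (\<mu> n)) \<^bold>\<and> pointwise_null \<mu> \<^bold>\<longrightarrow> weak_star_null \<mu>) q"
    using nik unfolding nikodym_property_def by simp
  moreover have "((\<^bold>\<forall>n. ba_measure (\<mu> n)) \<^bold>\<and> pointwise_null \<mu>) r"
    by (intro fAndI fAllI ba_measure_\<mu> pointwise_null_\<mu> order_refl)
  \<comment> \<open>An implication forced at q gives its conclusion only at some condition below r;
    the refutation holds at all of these.\<close>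
  ultimately obtain s where "s \<le> r" "weak_star_null \<mu> s"
    using r(1) unfolding fImp_iff[of _ _ q] by blast
  then show False using not_weak_star_null by blast
qed

end
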